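(* Let $\mathcal{T}$ be a finite collection of distinct prototiles in $\mathbb{R}^d$ and let $X_{\mathcal{T}}$ be the associated full tiling space. Then $X_{\mathcal{T}}$ has finite local complexity under translation if and only if the metric space $(X_{\mathcal{T}}, d_1)$ is compact.
   Context: Fix $d\ge 1$ and a norm $\|\cdot\|$ on $\mathbb{R}^d$. For $r>0$, $B_r$ is the closed ball of radius $r$ centered at the origin. A tile is a nonempty compact connected subset of $\mathbb{R}^d$ that equals the closure of its interior. A tiling is a collection of tiles with pairwise disjoint interiors whose union is $\mathbb{R}^d$. Two tiles are equivalent if one is a translate of the other; the equivalence classes are called prototiles. For a finite collection $\mathcal{T}$ of prototiles, the full tiling space $X_{\mathcal{T}}$ is the set of all tilings of $\mathbb{R}^d$ each of whose tiles belongs to some prototile in $\mathcal{T}$. A ($\mathcal{T}$-)patch is a nonempty finite subset $y$ of some tiling $x\in X_{\mathcal{T}}$ such that the union of the tiles in $y$, called its support $\operatorname{supp}(y)$, is connected. For a set $x$ of tiles and $v\in\mathbb{R}^d$, $T_v x:=\{D-v : D\in x\}$. Two patches are equivalent if one is a translate of the other; the classes are called protopatches. $\mathcal{T}^{(n)}$ denotes the set of protopatches whose representatives consist of exactly $n$ tiles. $X_{\mathcal{T}}$ has finite local complexity under translation if $\mathcal{T}$ is a finite set of prototiles and $\mathcal{T}^{(2)}$ is finite. For $x\in X_{\mathcal{T}}$ and a compact connected set $K\subset\mathbb{R}^d$, $x[[K]]$ denotes the set of patches $x'\subset x$ with $K\subset\operatorname{supp}(x')$. The tiling metric is $d_1(x,y)=\min\left(\frac{1}{\sqrt2},\tilde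 d_1(x,y)\right)$, where $$\tilde d_1(x,y)=\inf\left\{0<r<\tfrac{1}{\sqrt2} : \exists x'\in x[[B_{1/r}]],\ \exists y'\in y[[B_{1/r}]],\ \exists v\in B_r,\ T_v x'=y'\right\}$$ (with $\inf\emptyset=+\infty$). *)

theory Defs
  imports "HOL-Analysis.Analysis"
begin

text \<open>An arbitrary norm on the space, used only for the balls \<open>norm_ball\<close>; all topological
  notions are the standard ones, which every norm on a finite-dimensional space induces.\<close>

definition is_norm :: "('a::real_vector \<Rightarrow> real) \<Rightarrow> bool" where
  "is_norm N \<longleftrightarrow>
     (\<forall>u. 0 \<le> N u) \<and>
     (\<forall>u. N u = 0 \<longleftrightarrow> u = 0) \<and>
     (\<forall>c u. N (c *\<^sub>R u) = \<bar>c\<bar> * N u) \<and>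
     (\<forall>u v. N (u + v) \<le> N u + N v)"

definition norm_ball :: "('a \<Rightarrow> real) \<Rightarrow> real \<Rightarrow> 'a set" where
  "norm_ball N r = {u. N u \<le> r}"

definition tile :: "'a::euclidean_space set \<Rightarrow> bool" where
  "tile D \<longleftrightarrow> D \<noteq> {} \<and> compact D \<and> connected D \<and> D = closure (interior D)"

definition tiling :: "'a::euclidean_space set set \<Rightarrow> bool" where
  "tiling x \<longleftrightarrow> (\<forall>D\<in>x. tile D) \<and> pairwise (\<lambda>D E. interior D \<inter> interior E = {}) x \<and> \<Union>x = UNIV"

definition translate :: "'a::euclidean_space \<Rightarrow> 'a set set \<Rightarrow> 'a set set" where
  "translate v x = (\<lambda>D. (\<lambda>p. p - v) ` D) ` x"

definition tile_equiv :: "('a::euclidean_space set \<times> 'a set) set" where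
  "tile_equiv = {(D, E). tile D \<and> tile E \<and> (\<exists>v. E = (\<lambda>p. p - v) ` D)}"

definition prototiles :: "'a::euclidean_space set set set" where
  "prototiles = Collect tile // tile_equiv"

definition tiling_space :: "'a::euclidean_space set set set \<Rightarrow> 'a set set set" where
  "tiling_space \<T> = {x. tiling x \<and> (\<forall>D\<in>x. \<exists>P\<in>\<T>. D \<in> P)}"

abbreviation supp :: "'a set set \<Rightarrow> 'a set" where
  "supp y \<equiv> \<Union>y"

definition patches :: "'a::euclidean_space set set set \<Rightarrow> 'a set set set" where
  "patches \<T> = {y. y \<noteq> {} \<and> finite y \<and> (\<exists>x\<in>tiling_space \<T>. y \<subseteq> x) \<and> connected (supp y)}"

definition patch_equiv :: "'a::euclidean_space set set set \<Rightarrow> ('a set set \<times> 'a set set) set" where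
  "patch_equiv \<T> = {(y, z). y \<in> patches \<T> \<and> z \<in> patches \<T> \<and> (\<exists>v. z = translate v y)}"

definition protopatches :: "'a::euclidean_space set set set \<Rightarrow> nat \<Rightarrow> 'a set set set set" where
  "protopatches \<T> n = {Q \<in> patches \<T> // patch_equiv \<T>. \<forall>y\<in>Q. card y = n}"

definition finite_local_complexity :: "'a::euclidean_space set set set \<Rightarrow> bool" where
  "finite_local_complexity \<T> \<longleftrightarrow>
     finite \<T> \<and> \<T> \<subseteq> prototiles \<and> finite (protopatches \<T> 2)"

definition covering_patches ::
    "'a::euclidean_space set set set \<Rightarrow> 'a set set \<Rightarrow> 'a set \<Rightarrow> 'a set set set" where
  "covering_patches \<T> x K = {x' \<in> patches \<T>. x' \<subseteq> x \<and> K \<subseteq> supp x'}"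

definition matching_radii ::
    "('a::euclidean_space \<Rightarrow> real) \<Rightarrow> 'a set set set \<Rightarrow> 'a set set \<Rightarrow> 'a set set \<Rightarrow> real set" where
  "matching_radii N \<T> x y = {r. 0 < r \<and> r < 1 / sqrt 2 \<and>
     (\<exists>x' \<in> covering_patches \<T> x (norm_ball N (1 / r)).
      \<exists>y' \<in> covering_patches \<T> y (norm_ball N (1 / r)).
      \<exists>v \<in> norm_ball N r. translate v x' = y')}"

text \<open>The infimum is taken in the extended reals, so that it is \<open>\<infinity>\<close> when no radius matches.\<close>

definition tiling_dist ::
    "('a::euclidean_space \<Rightarrow> real) \<Rightarrow> 'a set set set \<Rightarrow> 'a set set \<Rightarrow> 'a set set \<Rightarrow> real" where
  "tiling_dist N \<T> x y =
     real_of_ereal (min (ereal (1 / sqrt 2)) (INF r\<in>matching_radii N \<T> x y. ereal r))"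

text \<open>The facts below lead to \<open>Metric_space_tiling_dist\<close>: \<open>tiling_dist\<close> is a metric on the full
  tiling space of finitely many prototiles, so its \<open>Metric_space.mtopology\<close> is the metric topology.\<close>

lemma is_normD:
  assumes "is_norm N"
  shows "0 \<le> N u" "N u = 0 \<longleftrightarrow> u = 0" "N (c *\<^sub>R u) = \<bar>c\<bar> * N u" "N (u + v) \<le> N u + N v" "N (- u) = N u"
        "N 0 = 0"
proof -
  show "0 \<le> N u" "N u = 0 \<longleftrightarrow> u = 0" "N (c *\<^sub>R u) = \<bar>c\<bar> * N u" "N (u + v) \<le> N u + N v" "N 0 = 0"
    using assms unfolding is_norm_def by auto
  have "N ((-1) *\<^sub>R u) = \<bar>-1\<bar> * N u" using assms unfolding is_norm_def by blast
  then show "N (- u) = N u" by simp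
qed

lemma is_norm_bounded:
  fixes N :: "'a::euclidean_space \<Rightarrow> real"
  assumes "is_norm N"
  shows "\<exists>C>0. \<forall>u. N u \<le> C * norm u"
proof -
  have sumN: "N (\<Sum>b\<in>B. f b) \<le> (\<Sum>b\<in>B. N (f b))" if "finite B" for B :: "'a set" and f
    using that
  proof (induction B rule: finite_induct)
    case empty then show ?case by (simp add: is_normD(6)[OF assms])
  next
    case (insert b B)
    then show ?case using is_normD(4)[OF assms, of "f b" "\<Sum>b\<in>B. f b"] by simp
  qed
  define C where "C = (\<Sum>b\<in>Basis. N b) + 1"
  have C: "(\<Sum>b\<in>Basis. N b) \<ge> 0" by (intro sum_nonneg is_normD(1)[OF assms])
  have "N u \<le> C * norm u" for u
  proof -
    have "N u = N (\<Sum>b\<in>Basis. (u \<bullet> b) *\<^sub>R b)" by (simp add: euclidean_representation)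
    also have "\<dots> \<le> (\<Sum>b\<in>Basis. N ((u \<bullet> b) *\<^sub>R b))" by (rule sumN) simp
    also have "\<dots> = (\<Sum>b\<in>Basis. \<bar>u \<bullet> b\<bar> * N b)" by (simp add: is_normD(3)[OF assms])
    also have "\<dots> \<le> (\<Sum>b\<in>Basis. norm u * N b)"
      by (intro sum_mono mult_right_mono Basis_le_norm is_normD(1)[OF assms])
    also have "\<dots> = norm u * (\<Sum>b\<in>Basis. N b)" by (simp add: sum_distrib_left)
    also have "\<dots> \<le> C * norm u" by (simp add: C_def algebra_simps)
    finally show ?thesis .
  qed
  moreover have "C > 0" using C by (simp add: C_def)
  ultimately show ?thesis by blast
qed

lemma is_norm_continuous:
  fixes N :: "'a::euclidean_space \<Rightarrow> real"
  assumes "is_norm N"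
  shows "continuous_on S N"
proof -
  obtain C where C: "C > 0" "\<And>u. N u \<le> C * norm u" using is_norm_bounded[OF assms] by blast
  have "\<bar>N u - N v\<bar> \<le> C * norm (u - v)" for u v
  proof -
    have "N u \<le> N (u - v) + N v" "N v \<le> N (v - u) + N u"
      using is_normD(4)[OF assms, of "u - v" v] is_normD(4)[OF assms, of "v - u" u] by auto
    moreover have "N (v - u) = N (u - v)" using is_normD(5)[OF assms, of "u - v"] by simp
    ultimately show ?thesis using C(2)[of "u - v"] by linarith
  qed
  then have "C-lipschitz_on S N"
    using C by (intro lipschitz_onI) (auto simp: dist_norm dist_real_def)
  then show ?thesis by (rule lipschitz_on_continuous_on)
qed

lemma is_norm_lower:
  fixes N :: "'a::euclidean_space \<Rightarrow> real"
  assumes "is_norm N"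
  shows "\<exists>c>0. \<forall>u. c * norm u \<le> N u"
proof -
  have "sphere (0::'a) 1 \<noteq> {}" by simp
  then obtain w where w: "w \<in> sphere 0 1" "\<And>u. u \<in> sphere 0 1 \<Longrightarrow> N w \<le> N u"
    using continuous_attains_inf[OF compact_sphere _ is_norm_continuous[OF assms]] by blast
  have "w \<noteq> 0" using w by auto
  then have pos: "N w > 0" using is_normD(1,2)[OF assms, of w] by linarith
  have "N w * norm u \<le> N u" for u
  proof (cases "u = 0")
    case False
    then have "N w \<le> N ((1 / norm u) *\<^sub>R u)" by (intro w(2)) simp
    also have "\<dots> = N u / norm u" by (simp add: is_normD(3)[OF assms])
    finally show ?thesis using False by (simp add: field_simps)
  qed (simp add: is_normD(6)[OF assms])
  with pos show ?thesis by blast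
qed

lemma norm_ball_props:
  fixes N :: "'a::euclidean_space \<Rightarrow> real"
  assumes "is_norm N"
  shows "convex (norm_ball N r)" "closed (norm_ball N r)" "bounded (norm_ball N r)"
    "0 < r \<Longrightarrow> 0 \<in> interior (norm_ball N r)"
proof -
  note n = is_normD[OF assms]
  show "convex (norm_ball N r)"
  proof (rule convexI)
    fix x y and u v :: real assume a: "x \<in> norm_ball N r" "y \<in> norm_ball N r" "0 \<le> u" "0 \<le> v" "u + v = 1"
    have "N (u *\<^sub>R x + v *\<^sub>R y) \<le> u * N x + v * N y"
      using n(4)[of "u *\<^sub>R x" "v *\<^sub>R y"] n(3)[of u x] n(3)[of v y] a by simp
    also have "\<dots> \<le> u * r + v * r" using a by (intro add_mono mult_left_mono) (auto simp: norm_ball_def)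
    also have "\<dots> = r" using a by (simp flip: distrib_right)
    finally show "u *\<^sub>R x + v *\<^sub>R y \<in> norm_ball N r" by (simp add: norm_ball_def)
  qed
  show "closed (norm_ball N r)" unfolding norm_ball_def
    by (intro closed_Collect_le is_norm_continuous[OF assms] continuous_on_const)
  obtain c where c: "c > 0" "\<And>u. c * norm u \<le> N u" using is_norm_lower[OF assms] by blast
  show "bounded (norm_ball N r)"
    unfolding bounded_iff
  proof (intro exI ballI)
    fix u assume "u \<in> norm_ball N r"
    then have "c * norm u \<le> r" using c(2)[of u] by (simp add: norm_ball_def)
    then show "norm u \<le> r / c" using c(1) by (simp add: field_simps)
  qed
  assume r: "0 < r"
  show "0 \<in> interior (norm_ball N r)"
  proof (rule interiorI[of "{u. N u < r}"])
    show "open {u. N u < r}"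
      by (intro open_Collect_less is_norm_continuous[OF assms] continuous_on_const)
  qed (use r n(6) in \<open>auto simp: norm_ball_def\<close>)
qed

lemma tiling_spaceD:
  assumes "x \<in> tiling_space \<T>"
  shows "\<And>D. D \<in> x \<Longrightarrow> tile D" "\<Union>x = UNIV" "\<And>D. D \<in> x \<Longrightarrow> \<exists>P\<in>\<T>. D \<in> P"
    "\<And>D E p. D \<in> x \<Longrightarrow> E \<in> x \<Longrightarrow> p \<in> interior D \<Longrightarrow> p \<in> E \<Longrightarrow> D = E"
proof -
  show *: "\<And>D. D \<in> x \<Longrightarrow> tile D" "\<Union>x = UNIV" "\<And>D. D \<in> x \<Longrightarrow> \<exists>P\<in>\<T>. D \<in> P"
    using assms unfolding tiling_space_def tiling_def by auto
  fix D E p assume DE: "D \<in> x" "E \<in> x" and p: "p \<in> interior D" "p \<in> E"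
  have "E = closure (interior E)" using *(1)[OF DE(2)] unfolding tile_def by blast
  then have "interior D \<inter> interior E \<noteq> {}"
    using p open_Int_closure_eq_empty[OF open_interior, of D "interior E"] by blast
  then show "D = E" using assms DE unfolding tiling_space_def tiling_def pairwise_def by blast
qed

lemma translate_props:
  "translate 0 x = x" "translate u (translate v x) = translate (v + u) x"
  "supp (translate v x) = (\<lambda>p. p - v) ` supp x"
  "x \<subseteq> y \<Longrightarrow> translate v x \<subseteq> translate v y"
  unfolding translate_def by (auto simp: image_image algebra_simps)

lemma prototile_translate:
  assumes "P \<in> prototiles" "D \<in> P" "E \<in> P"
  shows "\<exists>v. E = (\<lambda>p. p - v) ` D"
proof -
  obtain F where P: "P = tile_equiv `` {F}" using assms(1) unfolding prototiles_def quotient_def by blast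
  obtain v w where "D = (\<lambda>p. p - v) ` F" "E = (\<lambda>p. p - w) ` F"
    using assms(2,3) unfolding P tile_equiv_def by blast
  then have "E = (\<lambda>p. p - (w - v)) ` D" by (simp add: image_image)
  then show ?thesis by blast
qed

lemma tile_interior_nonempty: "tile D \<Longrightarrow> interior D \<noteq> {}"
  unfolding tile_def by (metis closure_empty)

lemma prototile_ball:
  fixes P :: "'a::euclidean_space set set"
  assumes "P \<in> prototiles"
  shows "\<exists>e>0. \<exists>R. \<forall>D\<in>P. \<exists>c. ball c e \<subseteq> D \<and> D \<subseteq> ball c R"
proof -
  obtain F where F: "tile F" and P: "P = tile_equiv `` {F}"
    using assms(1) unfolding prototiles_def quotient_def by blast
  obtain c where "c \<in> interior F" using tile_interior_nonempty[OF F] by blast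
  then obtain e where e: "e > 0" "ball c e \<subseteq> F" by (meson mem_interior)
  have "bounded F" using F unfolding tile_def by (simp add: compact_imp_bounded)
  then obtain R where R: "F \<subseteq> ball c R" using bounded_subset_ballD by blast
  have "\<exists>c. ball c e \<subseteq> D \<and> D \<subseteq> ball c R" if DP: "D \<in> P" for D
  proof -
    obtain v where D: "D = (\<lambda>p. p - v) ` F" using DP unfolding P tile_equiv_def by auto
    have b: "(\<lambda>p. p - v) ` ball c s = ball (c - v) s" for s
      using ball_translation[of "-v" c s] by (simp add: add.commute)
    have "ball (c - v) e \<subseteq> D \<and> D \<subseteq> ball (c - v) R"
      unfolding D b[symmetric] using e R by blast
    then show ?thesis by blast
  qed
  then show ?thesis using e by blast
qed

lemma prototiles_ball:
  fixes \<T> :: "'a::euclidean_space set set set"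
  assumes "finite \<T>" "\<T> \<subseteq> prototiles"
  shows "\<exists>e>0. \<exists>R. \<forall>P\<in>\<T>. \<forall>D\<in>P. \<exists>c. ball c e \<subseteq> D \<and> D \<subseteq> ball c R"
  using assms
proof (induction \<T> rule: finite_induct)
  case (insert P \<T>)
  have sub: "\<T> \<subseteq> prototiles" "P \<in> prototiles" using insert.prems by auto
  from insert.IH[OF sub(1)] obtain e R where 1: "e > 0"
    "\<forall>P\<in>\<T>. \<forall>D\<in>P. \<exists>c. ball c e \<subseteq> D \<and> D \<subseteq> ball c R" by blast
  from prototile_ball[OF sub(2)] obtain e' R' where 2: "e' > 0"
    "\<forall>D\<in>P. \<exists>c. ball c e' \<subseteq> D \<and> D \<subseteq> ball c R'" by blast
  have mono: "ball c (min e e') \<subseteq> ball c e" "ball c (min e e') \<subseteq> ball c e'"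
    "ball c R \<subseteq> ball c (max R R')" "ball c R' \<subseteq> ball c (max R R')" for c :: 'a
    by (auto intro!: subset_ball)
  have "\<exists>c. ball c (min e e') \<subseteq> D \<and> D \<subseteq> ball c (max R R')" if QD: "Q \<in> insert P \<T>" "D \<in> Q" for Q D
  proof (cases "Q = P")
    case True
    then have "\<exists>c. ball c e' \<subseteq> D \<and> D \<subseteq> ball c R'" using 2(2) QD(2) by simp
    then show ?thesis using mono(2,4) by (meson order_trans)
  next
    case False
    then have "\<exists>c. ball c e \<subseteq> D \<and> D \<subseteq> ball c R" using 1(2) QD by simp
    then show ?thesis using mono(1,3) by (meson order_trans)
  qed
  then have "\<forall>Q\<in>insert P \<T>. \<forall>D\<in>Q. \<exists>c. ball c (min e e') \<subseteq> D \<and> D \<subseteq> ball c (max R R')"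
    by (intro ballI)
  moreover have "min e e' > 0" using 1(1) 2(1) by simp
  ultimately show ?case by (intro exI conjI)
next
  case empty
  have "(1::real) > 0" by simp
  then show ?case by blast
qed

lemma tiling_locally_finite:
  fixes \<T> :: "'a::euclidean_space set set set"
  assumes "finite \<T>" "\<T> \<subseteq> prototiles" "x \<in> tiling_space \<T>" "bounded B"
  shows "finite {D\<in>x. D \<inter> B \<noteq> {}}"
proof -
  from prototiles_ball[OF assms(1,2)] obtain e R where e: "e > 0"
    "\<forall>P\<in>\<T>. \<forall>D\<in>P. \<exists>c. ball c e \<subseteq> D \<and> D \<subseteq> ball c R" by blast
  have "\<forall>D\<in>x. \<exists>c. ball c e \<subseteq> D \<and> D \<subseteq> ball c R"
  proof
    fix D assume "D \<in> x"
    then obtain P where "P \<in> \<T>" "D \<in> P" using tiling_spaceD(3)[OF assms(3)] by blast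
    then show "\<exists>c. ball c e \<subseteq> D \<and> D \<subseteq> ball c R" using e(2) by simp
  qed
  from bchoice[OF this] obtain c where c: "\<And>D. D \<in> x \<Longrightarrow> ball (c D) e \<subseteq> D \<and> D \<subseteq> ball (c D) R" by blast
  let ?S = "{D\<in>x. D \<inter> B \<noteq> {}}"
  have sep: "D = E" if "D \<in> x" "E \<in> x" "dist (c D) (c E) < e" for D E
  proof (rule tiling_spaceD(4)[OF assms(3) that(1,2)])
    show "c E \<in> interior D" using c[OF that(1)] that(3) by (intro interiorI[of "ball (c D) e"]) auto
    show "c E \<in> E" using c[OF that(2)] e(1) by auto
  qed
  have "inj_on c ?S"
  proof (rule inj_onI)
    fix D E assume "D \<in> ?S" "E \<in> ?S" "c D = c E"
    then show "D = E" using e(1) by (intro sep) auto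
  qed
  moreover have "finite (c ` ?S)"
  proof -
    obtain b where b: "\<And>p. p \<in> B \<Longrightarrow> norm p \<le> b" using assms(4) unfolding bounded_iff by blast
    have "bounded (c ` ?S)" unfolding bounded_iff
    proof (intro exI ballI)
      fix q assume "q \<in> c ` ?S"
      then obtain D p where D: "D \<in> x" "p \<in> D" "p \<in> B" "q = c D" by blast
      then have "dist q p < R" using c[OF D(1)] by auto
      then show "norm q \<le> R + b" using b[OF D(3)] norm_triangle_ineq2[of q p] by (simp add: dist_norm)
    qed
    moreover have "uniform_discrete (c ` ?S)"
      unfolding uniform_discrete_def
    proof (intro exI[of _ e] conjI ballI impI)
      fix p q assume pq: "p \<in> c ` ?S" "q \<in> c ` ?S" "dist p q < e"
      then obtain D E where "D \<in> x" "p = c D" "E \<in> x" "q = c E" by blast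
      then show "p = q" using sep[of D E] pq(3) by blast
    qed (rule e(1))
    ultimately show ?thesis using uniform_discrete_finite_iff by blast
  qed
  ultimately show ?thesis by (rule finite_imageD[rotated])
qed

lemma connected_supp_touching:
  assumes "\<And>E. E \<in> y \<Longrightarrow> connected E \<and> E \<inter> L \<noteq> {}" "connected L" "L \<subseteq> \<Union>y"
  shows "connected (\<Union>y)"
proof (cases "L = {}")
  case True
  then show ?thesis using assms(1) by (metis Int_empty_right Union_empty connected_empty equals0I)
next
  case False
  then obtain p where p: "p \<in> L" by blast
  have "\<Union>y = \<Union>((\<lambda>E. E \<union> L) ` insert L y)" using assms(3) by auto
  moreover have "connected (\<Union>((\<lambda>E. E \<union> L) ` insert L y))"
  proof (rule connected_Union)
    show "\<And>S. S \<in> (\<lambda>E. E \<union> L) ` insert L y \<Longrightarrow> connected S"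
      using assms(1,2) by (auto intro!: connected_Un)
    show "\<Inter>((\<lambda>E. E \<union> L) ` insert L y) \<noteq> {}" using p by auto
  qed
  ultimately show ?thesis by simp
qed

lemma patch_touching:
  assumes "x \<in> tiling_space \<T>" "M \<subseteq> x" "finite {E\<in>M. E \<inter> L \<noteq> {}}" "connected L" "L \<noteq> {}" "L \<subseteq> \<Union>M"
  shows "{E\<in>M. E \<inter> L \<noteq> {}} \<in> covering_patches \<T> x L"
proof -
  let ?y = "{E\<in>M. E \<inter> L \<noteq> {}}"
  have L: "L \<subseteq> \<Union>?y" using assms(6) by auto
  then have "?y \<noteq> {}" using assms(5) by blast
  moreover have "connected (\<Union>?y)"
    by (rule connected_supp_touching[OF _ assms(4) L])
       (use tiling_spaceD(1)[OF assms(1)] assms(2) in \<open>auto simp: tile_def\<close>)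
  moreover have "?y \<subseteq> x" using assms(2) by auto
  ultimately show ?thesis unfolding covering_patches_def patches_def using assms(1,3) L by blast
qed

lemma patch_translate:
  assumes "y \<in> patches \<T>" "translate v y \<subseteq> x" "x \<in> tiling_space \<T>"
  shows "translate v y \<in> patches \<T>"
proof -
  have "connected (supp (translate v y))"
    unfolding translate_props using assms(1)
    by (intro connected_continuous_image continuous_intros) (auto simp: patches_def)
  moreover have "translate v y \<noteq> {}" "finite (translate v y)"
    using assms(1) by (auto simp: patches_def translate_def)
  ultimately show ?thesis unfolding patches_def using assms(2,3) by blast
qed

lemma matching_radii_sym: 
  assumes "is_norm N" shows "matching_radii N \<T> x y = matching_radii N \<T> y x"
proof -
  have "matching_radii N \<T> x y \<subseteq> matching_radii N \<T> y x" for x y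
  proof
    fix r assume "r \<in> matching_radii N \<T> x y"
    then obtain x' y' v where r: "0 < r" "r < 1 / sqrt 2"
      "x' \<in> covering_patches \<T> x (norm_ball N (1 / r))" "y' \<in> covering_patches \<T> y (norm_ball N (1 / r))"
      "v \<in> norm_ball N r" "translate v x' = y'" unfolding matching_radii_def by blast
    have "translate (-v) y' = x'" using translate_props(1,2) r(6) by (metis add.right_inverse)
    moreover have "-v \<in> norm_ball N r" using r(5) is_normD(5)[OF assms] by (simp add: norm_ball_def)
    ultimately show "r \<in> matching_radii N \<T> y x" unfolding matching_radii_def using r by blast
  qed
  then show ?thesis by blast
qed

lemma tiling_dist_bounds: "0 \<le> tiling_dist N \<T> x y" "tiling_dist N \<T> x y \<le> 1 / sqrt 2"
  and tiling_dist_less_iff: "t \<le> 1 / sqrt 2 \<Longrightarrow>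
    tiling_dist N \<T> x y < t \<longleftrightarrow> (\<exists>r\<in>matching_radii N \<T> x y. r < t)"
proof -
  define m where "m = min (ereal (1 / sqrt 2)) (INF r\<in>matching_radii N \<T> x y. ereal r)"
  have m: "0 \<le> m" unfolding m_def by (auto intro!: INF_greatest simp: matching_radii_def)
  have m2: "m \<le> ereal (1 / sqrt 2)" unfolding m_def by simp
  obtain a where a: "m = ereal a" using m m2 by (cases m) auto
  have d: "tiling_dist N \<T> x y = a" unfolding tiling_dist_def m_def[symmetric] a by simp
  show "0 \<le> tiling_dist N \<T> x y" "tiling_dist N \<T> x y \<le> 1 / sqrt 2" using m m2 a d by auto
  assume t: "t \<le> 1 / sqrt 2"
  have "a < t \<longleftrightarrow> m < ereal t" using a by simp
  also have "\<dots> \<longleftrightarrow> (\<exists>r\<in>matching_radii N \<T> x y. r < t)"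
    using t unfolding m_def min_less_iff_disj INF_less_iff by (auto simp: matching_radii_def)
  finally show "tiling_dist N \<T> x y < t \<longleftrightarrow> (\<exists>r\<in>matching_radii N \<T> x y. r < t)" using d by simp
qed

lemma tiling_dist_refl:
  assumes "is_norm N" "finite \<T>" "\<T> \<subseteq> prototiles" "x \<in> tiling_space \<T>"
  shows "tiling_dist N \<T> x x = 0"
proof (rule ccontr)
  assume "tiling_dist N \<T> x x \<noteq> 0"
  define t where "t = tiling_dist N \<T> x x"
  have t: "0 < t" "t \<le> 1 / sqrt 2"
    using tiling_dist_bounds[of N \<T> x x] \<open>_ \<noteq> 0\<close> unfolding t_def by auto
  define r where "r = t / 2"
  have r: "0 < r" "r < t" using t by (auto simp: r_def)
  let ?B = "norm_ball N (1 / r)"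
  have nb: "0 \<in> ?B" using norm_ball_props(4)[OF assms(1), of "1 / r"] r interior_subset by auto
  have "{E\<in>x. E \<inter> ?B \<noteq> {}} \<in> covering_patches \<T> x ?B"
  proof (rule patch_touching[OF assms(4)])
    show "finite {E\<in>x. E \<inter> ?B \<noteq> {}}"
      by (rule tiling_locally_finite[OF assms(2-4) norm_ball_props(3)[OF assms(1)]])
    show "connected ?B" using norm_ball_props(1)[OF assms(1)] convex_connected by blast
  qed (use nb tiling_spaceD(2)[OF assms(4)] in auto)
  moreover have "0 \<in> norm_ball N r" using r is_normD(6)[OF assms(1)] by (simp add: norm_ball_def)
  moreover have "r < 1 / sqrt 2" using r t by linarith
  ultimately have "r \<in> matching_radii N \<T> x x"
    unfolding matching_radii_def using r(1) translate_props(1) by blast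
  then have "tiling_dist N \<T> x x < t" using tiling_dist_less_iff[OF t(2)] r by blast
  then show False by (simp add: t_def)
qed

lemma tiling_dist_0_subset:
  assumes N: "is_norm N" and x: "x \<in> tiling_space \<T>" and y: "y \<in> tiling_space \<T>"
    and d: "tiling_dist N \<T> x y = 0"
  shows "x \<subseteq> y"
proof
  fix D assume D: "D \<in> x"
  have tD: "tile D" using tiling_spaceD(1)[OF x D] .
  obtain p where p: "p \<in> interior D" using tile_interior_nonempty[OF tD] by blast
  then obtain e where e: "e > 0" "ball p e \<subseteq> D" by (meson mem_interior)
  obtain c where c: "c > 0" "\<And>u. c * norm u \<le> N u" using is_norm_lower[OF N] by blast
  have *: "\<exists>v. norm v < s \<and> (\<lambda>q. q - v) ` D \<in> y" if s: "s > 0" for s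
  proof -
    define t where "t = min (1 / sqrt 2) (min (1 / (N p + 1)) (c * s))"
    have Np: "0 \<le> N p" using is_normD(1)[OF N] .
    have t: "0 < t" "t \<le> 1 / sqrt 2" "t \<le> 1 / (N p + 1)" "t \<le> c * s"
      using Np c s by (auto simp: t_def)
    obtain r where r: "r \<in> matching_radii N \<T> x y" "r < t"
      using tiling_dist_less_iff[OF t(2), of N \<T> x y] d t(1) by auto
    then obtain x' y' v where r': "0 < r" 
      "x' \<in> covering_patches \<T> x (norm_ball N (1 / r))" "y' \<in> covering_patches \<T> y (norm_ball N (1 / r))"
      "v \<in> norm_ball N r" "translate v x' = y'" unfolding matching_radii_def by blast
    have "r \<le> 1 / (N p + 1)" using r(2) t(3) by linarith
    then have "N p \<le> 1 / r" using r'(1) Np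
      by (simp add: field_simps)
    then obtain E where E: "E \<in> x'" "p \<in> E" using r'(2) unfolding covering_patches_def norm_ball_def by blast
    have "E \<in> x" using E r'(2) unfolding covering_patches_def by blast
    then have "D = E" using tiling_spaceD(4)[OF x D _ p E(2)] by blast
    then have "(\<lambda>q. q - v) ` D \<in> y" using E(1) r'(3,5) unfolding covering_patches_def translate_def by blast
    moreover have "norm v < s"
    proof -
      have "c * norm v \<le> r" using c(2)[of v] r'(4) by (simp add: norm_ball_def)
      then have "c * norm v < c * s" using r(2) t(4) by linarith
      then show ?thesis using c(1) by simp
    qed
    ultimately show ?thesis by blast
  qed
  obtain v0 where v0: "norm v0 < e" "(\<lambda>q. q - v0) ` D \<in> y" using *[OF e(1)] by blast
  define E where "E = (\<lambda>q. q - v0) ` D"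
  have inter: "p \<in> interior ((\<lambda>q. q - v) ` D)" if "norm v < e" for v
  proof (rule interiorI[of "ball (p - v) e"])
    show "p \<in> ball (p - v) e" using that by (simp add: dist_norm)
    have "ball (p - v) e = (\<lambda>q. q - v) ` ball p e"
      using ball_translation[of "-v" p e] by (simp add: add.commute)
    then show "ball (p - v) e \<subseteq> (\<lambda>q. q - v) ` D" using e(2) by blast
  qed simp
  have **: "\<exists>v. norm v < s \<and> (\<lambda>q. q - v) ` D = E" if s: "s > 0" for s
  proof -
    obtain v where v: "norm v < min s e" "(\<lambda>q. q - v) ` D \<in> y" using *[of "min s e"] s e(1) by auto
    have "p \<in> interior ((\<lambda>q. q - v) ` D)" using v(1) by (intro inter) linarith
    moreover have "p \<in> (\<lambda>q. q - v0) ` D" using inter[OF v0(1)] interior_subset by (rule rev_subsetD)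
    ultimately have "(\<lambda>q. q - v) ` D = E" unfolding E_def
      by (rule tiling_spaceD(4)[OF y v(2) v0(2)])
    moreover have "norm v < s" using v(1) by linarith
    ultimately show ?thesis by (intro exI conjI)
  qed
  have Ey: "E \<in> y" using v0(2) E_def by simp
  have cl: "closed D" "closed E"
    using tD tiling_spaceD(1)[OF y Ey] by (auto simp: tile_def compact_imp_closed)
  have "q \<in> E" if "q \<in> D" for q
  proof -
    have "\<exists>q'\<in>E. dist q' q < s" if s: "s > 0" for s
    proof -
      obtain v where v: "norm v < s" "(\<lambda>q. q - v) ` D = E" using **[OF s] by (elim exE conjE) (rule that)
      then have "q - v \<in> E" using \<open>q \<in> D\<close> by blast
      then show ?thesis using v(1) by (intro bexI[of _ "q - v"]) (auto simp: dist_norm)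
    qed
    then show ?thesis using closed_approachable[OF cl(2)] by blast
  qed
  moreover have "q \<in> D" if "q \<in> E" for q
  proof -
    have "\<exists>q'\<in>D. dist q' q < s" if s: "s > 0" for s
    proof -
      obtain v where v: "norm v < s" "(\<lambda>q. q - v) ` D = E" using **[OF s] by (elim exE conjE) (rule that)
      then obtain q' where "q' \<in> D" "q = q' - v" using \<open>q \<in> E\<close> by blast
      then show ?thesis using v(1) by (intro bexI[of _ q']) (auto simp: dist_norm)
    qed
    then show ?thesis using closed_approachable[OF cl(1)] by blast
  qed
  ultimately have "D = E" by blast
  then show "D \<in> y" using Ey by simp
qed

lemma radii_arith:
  fixes a b :: real
  assumes "0 < a" "0 < b" "a + b < 1 / sqrt 2"
  shows "1 / (a + b) + a \<le> 1 / b" "a \<le> 1 / (a + b)" "b \<le> 1 / (a + b)"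
proof -
  have "1 / sqrt 2 < (1::real)" by simp
  then have s: "a + b < 1" using assms(3) by linarith
  have sq: "b * (a + b) \<le> 1" "a * (a + b) \<le> 1"
    using s assms by (auto intro!: mult_le_one)
  then show "a \<le> 1 / (a + b)" "b \<le> 1 / (a + b)" using assms by (auto simp: field_simps)
  have "b + a * (b * (a + b)) \<le> b + a * 1" using sq(1) assms by (intro add_left_mono mult_left_mono) auto
  moreover have "(1 / (a + b) + a) * (b * (a + b)) = b + a * (b * (a + b))"
    using assms by (simp add: field_simps)
  moreover have "1 / b * (b * (a + b)) = a + b" using assms by (simp add: field_simps)
  ultimately have "(1 / (a + b) + a) * (b * (a + b)) \<le> 1 / b * (b * (a + b))" by linarith
  then show "1 / (a + b) + a \<le> 1 / b" using assms
    by (meson add_pos_pos mult_pos_pos mult_le_cancel_right_pos)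
qed

lemma cover_inter:
  assumes "y \<in> tiling_space \<T>" "finite y1" "finite y2" "y1 \<subseteq> y" "y2 \<subseteq> y"
    and "L \<subseteq> \<Union>y1" "L \<subseteq> \<Union>y2" "L \<subseteq> closure (interior L)"
  shows "L \<subseteq> \<Union>(y1 \<inter> y2)"
proof -
  have "closed (\<Union>(y1 \<inter> y2))"
    using assms(2,4) tiling_spaceD(1)[OF assms(1)]
    by (intro closed_Union) (auto simp: tile_def compact_imp_closed)
  moreover have "interior L \<subseteq> closure (\<Union>(y1 \<inter> y2))"
  proof (rule subsetI, rule ccontr)
    fix p assume p: "p \<in> interior L" "p \<notin> closure (\<Union>(y1 \<inter> y2))"
    let ?U = "interior L - closure (\<Union>(y1 \<inter> y2))"
    have U: "open ?U" by (intro open_Diff) auto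
    obtain E where E: "E \<in> y1" "p \<in> E" using p(1) interior_subset assms(6) by blast
    have "tile E" using E(1) assms(1,4) tiling_spaceD(1) by blast
    then have "E = closure (interior E)" unfolding tile_def by blast
    then have "?U \<inter> interior E \<noteq> {}" using p E(2) open_Int_closure_eq_empty[OF U, of "interior E"] by blast
    then obtain q where q: "q \<in> ?U" "q \<in> interior E" by blast
    then obtain F where F: "F \<in> y2" "q \<in> F" using interior_subset assms(7) by blast
    have "E = F" using tiling_spaceD(4)[OF assms(1) _ _ q(2) F(2)] E F assms(4,5) by blast
    then have "q \<in> \<Union>(y1 \<inter> y2)" using E F by blast
    then have "q \<in> closure (\<Union>(y1 \<inter> y2))" using closure_subset by (rule rev_subsetD)
    then show False using q(1) by simp
  qed
  ultimately have "interior L \<subseteq> \<Union>(y1 \<inter> y2)" "closed (\<Union>(y1 \<inter> y2))" by (auto simp only: closure_closed)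
  then have "closure (interior L) \<subseteq> \<Union>(y1 \<inter> y2)" by (rule closure_minimal)
  then show ?thesis by (rule order_trans[OF assms(8)])
qed

lemma matching_radii_add:
  assumes N: "is_norm N" and x: "x \<in> tiling_space \<T>" and y: "y \<in> tiling_space \<T>" and z: "z \<in> tiling_space \<T>"
    and a: "a \<in> matching_radii N \<T> x y" and b: "b \<in> matching_radii N \<T> y z" and ab: "a + b < 1 / sqrt 2"
  shows "a + b \<in> matching_radii N \<T> x z"
proof -
  note n = is_normD[OF N]
  obtain x' y' v where A: "0 < a" 
    "x' \<in> covering_patches \<T> x (norm_ball N (1 / a))" "y' \<in> covering_patches \<T> y (norm_ball N (1 / a))"
    "v \<in> norm_ball N a" "translate v x' = y'" using a unfolding matching_radii_def by blast
  obtain y'' z' w where B: "0 < b" 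
    "y'' \<in> covering_patches \<T> y (norm_ball N (1 / b))" "z' \<in> covering_patches \<T> z (norm_ball N (1 / b))"
    "w \<in> norm_ball N b" "translate w y'' = z'" using b unfolding matching_radii_def by blast
  define R where "R = 1 / (a + b)"
  have R: "0 < R" "R + a \<le> 1 / b" "R + b \<le> 1 / a" "a \<le> R" "b \<le> R"
    using radii_arith[OF A(1) B(1) ab] radii_arith(1)[OF B(1) A(1)] ab A(1) B(1)
    by (auto simp: R_def add.commute)
  let ?B = "norm_ball N R"
  define L1 where "L1 = (\<lambda>p. p + (- v)) ` ?B"
  define L2 where "L2 = (\<lambda>p. p + w) ` ?B"
  have vw: "N v \<le> a" "N w \<le> b" using A(4) B(4) by (auto simp: norm_ball_def)
  have L1b: "L1 \<subseteq> norm_ball N (R + a)"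
  proof
    fix q assume "q \<in> L1"
    then obtain p where p: "q = p + (- v)" "N p \<le> R" by (auto simp: L1_def norm_ball_def)
    then show "q \<in> norm_ball N (R + a)" using n(4)[of p "-v"] n(5)[of v] vw by (simp add: norm_ball_def)
  qed
  have L2b: "L2 \<subseteq> norm_ball N (R + b)"
  proof
    fix q assume "q \<in> L2"
    then obtain p where p: "q = p + w" "N p \<le> R" by (auto simp: L2_def norm_ball_def)
    then show "q \<in> norm_ball N (R + b)" using n(4)[of p w] vw by (simp add: norm_ball_def)
  qed
  have mono: "norm_ball N s \<subseteq> norm_ball N t" if "s \<le> t" for s t using that by (auto simp: norm_ball_def)
  have Ra: "R \<le> 1 / a" and Rb: "R \<le> 1 / b" using R A(1) B(1) by linarith+
  have bx: "?B \<subseteq> \<Union>x'" using A(2) mono[OF Ra] unfolding covering_patches_def by blast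
  have bz: "?B \<subseteq> \<Union>z'" using B(3) mono[OF Rb] unfolding covering_patches_def by blast
  have sy': "\<Union>y' = (\<lambda>p. p - v) ` \<Union>x'" using A(5) translate_props(3)[of v x'] by simp
  have sz': "\<Union>z' = (\<lambda>p. p - w) ` \<Union>y''" using B(5) translate_props(3)[of w y''] by simp
  have "L1 \<subseteq> \<Union>y'" unfolding sy' L1_def using bx by auto
  moreover have "L2 \<subseteq> \<Union>y''"
  proof
    fix q assume "q \<in> L2"
    then obtain p where p: "q = p + w" "p \<in> ?B" by (auto simp: L2_def)
    then have "p \<in> (\<lambda>p. p - w) ` \<Union>y''" using bz sz' by blast
    then show "q \<in> \<Union>y''" using p by auto
  qed
  moreover have "L1 \<subseteq> \<Union>y''" using L1b mono[OF R(2)] B(2) unfolding covering_patches_def by blast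
  moreover have "L2 \<subseteq> \<Union>y'" using L2b mono[OF R(3)] A(3) unfolding covering_patches_def by blast
  ultimately have Lsub: "L1 \<union> L2 \<subseteq> \<Union>y'" "L1 \<union> L2 \<subseteq> \<Union>y''" by auto
  have Bne: "interior ?B \<noteq> {}" using norm_ball_props(4)[OF N R(1)] by blast
  have reg: "?B \<subseteq> closure (interior ?B)"
    using convex_closure_interior[OF norm_ball_props(1)[OF N] Bne] closure_subset by blast
  have reg': "(\<lambda>p. p + u) ` ?B \<subseteq> closure (interior ((\<lambda>p. p + u) ` ?B))" for u
  proof -
    have "(\<lambda>p. p + u) ` ?B = (+) u ` ?B" by (simp add: add.commute)
    then show ?thesis using reg by (simp add: interior_translation closure_translation image_mono)
  qed
  have Lreg: "L1 \<union> L2 \<subseteq> closure (interior (L1 \<union> L2))"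
  proof -
    have "closure (interior L1) \<subseteq> closure (interior (L1 \<union> L2))" "closure (interior L2) \<subseteq> closure (interior (L1 \<union> L2))"
      by (auto intro!: closure_mono interior_mono)
    then show ?thesis using reg'[of "-v"] reg'[of w] unfolding L1_def L2_def by blast
  qed
  let ?L = "L1 \<union> L2"
  have y'y: "y' \<subseteq> y" "y'' \<subseteq> y" "finite y'" "finite y''"
    using A(3) B(2) by (auto simp: covering_patches_def patches_def)
  define M where "M = y' \<inter> y''"
  have LM: "?L \<subseteq> \<Union>M" unfolding M_def
    by (rule cover_inter[OF y y'y(3,4,1,2) Lsub Lreg])
  have zero: "0 \<in> L1" "0 \<in> L2"
  proof -
    have "v \<in> ?B" "- w \<in> ?B" using vw R n(5)[of w] by (auto simp: norm_ball_def)
    then show "0 \<in> L1" "0 \<in> L2" unfolding L1_def L2_def by force+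
  qed
  have conB: "connected ?B" using norm_ball_props(1)[OF N] convex_connected by blast
  have conL: "connected ?L"
  proof (rule connected_Un)
    show "connected L1" "connected L2" unfolding L1_def L2_def
      by (intro connected_continuous_image conB continuous_intros)+
  qed (use zero in auto)
  define ys where "ys = {E\<in>M. E \<inter> ?L \<noteq> {}}"
  have ys: "ys \<in> covering_patches \<T> y ?L" unfolding ys_def
    by (rule patch_touching[OF y]) (use y'y zero conL LM in \<open>auto simp: M_def\<close>)
  have ysM: "ys \<subseteq> y'" "ys \<subseteq> y''" by (auto simp: ys_def M_def)
  have ysP: "ys \<in> patches \<T>" "?L \<subseteq> \<Union>ys" using ys by (auto simp: covering_patches_def)
  define xs where "xs = translate (- v) ys"
  define zs where "zs = translate w ys"
  have "translate (- v) y' = x'" using translate_props(1,2) A(5) by (metis add.right_inverse)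
  then have xsx: "xs \<subseteq> x" using translate_props(4)[OF ysM(1), of "-v"] A(2)
    unfolding xs_def covering_patches_def by blast
  have zsz: "zs \<subseteq> z" using translate_props(4)[OF ysM(2), of w] B(3,5)
    unfolding zs_def covering_patches_def by blast
  have "?B \<subseteq> \<Union>xs"
  proof
    fix p assume "p \<in> ?B"
    then have "p + (- v) \<in> \<Union>ys" using ysP(2) unfolding L1_def by blast
    then have "(p + (- v)) - (- v) \<in> (\<lambda>p. p - (- v)) ` \<Union>ys" by (rule imageI)
    then show "p \<in> \<Union>xs" unfolding xs_def translate_props(3) by simp
  qed
  moreover have "?B \<subseteq> \<Union>zs"
  proof
    fix p assume "p \<in> ?B"
    then have "p + w \<in> \<Union>ys" using ysP(2) unfolding L2_def by blast
    then have "(p + w) - w \<in> (\<lambda>p. p - w) ` \<Union>ys" by (rule imageI)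
    then show "p \<in> \<Union>zs" unfolding zs_def translate_props(3) by simp
  qed
  moreover have "xs \<in> patches \<T>" "zs \<in> patches \<T>"
    using patch_translate[OF ysP(1)] xsx zsz x z unfolding xs_def zs_def by blast+
  ultimately have c: "xs \<in> covering_patches \<T> x ?B" "zs \<in> covering_patches \<T> z ?B"
    using xsx zsz by (auto simp: covering_patches_def)
  have "translate (v + w) xs = zs" unfolding xs_def zs_def translate_props(2) by simp
  moreover have "v + w \<in> norm_ball N (a + b)" using n(4)[of v w] vw by (simp add: norm_ball_def)
  ultimately have "\<exists>x' \<in> covering_patches \<T> x ?B. \<exists>y' \<in> covering_patches \<T> z ?B.
      \<exists>v \<in> norm_ball N (a + b). translate v x' = y'"
    using c by (intro bexI[of _ xs] bexI[of _ zs] bexI[of _ "v + w"])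
  moreover have "0 < a + b" using A(1) B(1) by simp
  ultimately show ?thesis unfolding matching_radii_def R_def using ab by simp
qed

lemma Metric_space_tiling_dist:
  assumes "is_norm N" "finite \<T>" "\<T> \<subseteq> prototiles"
  shows "Metric_space (tiling_space \<T>) (tiling_dist N \<T>)"
proof (rule Metric_space.intro)
  let ?d = "tiling_dist N \<T>"
  show "0 \<le> ?d x y" for x y by (rule tiling_dist_bounds)
  show sym: "?d x y = ?d y x" for x y
    unfolding tiling_dist_def matching_radii_sym[OF assms(1), of \<T> x y] by (rule refl)
  show "?d x y = 0 \<longleftrightarrow> x = y" if "x \<in> tiling_space \<T>" "y \<in> tiling_space \<T>" for x y
  proof
    assume 0: "?d x y = 0"
    then have "?d y x = 0" using sym[of x y] by simp
    then show "x = y"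
      using tiling_dist_0_subset[OF assms(1) that 0] tiling_dist_0_subset[OF assms(1) that(2,1)] by (intro subset_antisym)
  next
    assume "x = y"
    then show "?d x y = 0" using tiling_dist_refl[OF assms that(1)] by simp
  qed
  fix x y z assume xyz: "x \<in> tiling_space \<T>" "y \<in> tiling_space \<T>" "z \<in> tiling_space \<T>"
  show "?d x z \<le> ?d x y + ?d y z"
  proof (rule ccontr)
    assume c: "\<not> ?thesis"
    define g where "g = (?d x z - ?d x y - ?d y z) / 2"
    have g2: "2 * g = ?d x z - ?d x y - ?d y z" by (simp add: g_def)
    have g: "g > 0" using c by (simp add: g_def)
    have b: "?d x z \<le> 1 / sqrt 2" "0 \<le> ?d x y" "0 \<le> ?d y z" by (rule tiling_dist_bounds)+
    have 1: "?d x y + g \<le> 1 / sqrt 2" "?d y z + g \<le> 1 / sqrt 2"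
      using g g2 b by linarith+
    obtain r where r: "r \<in> matching_radii N \<T> x y" "r < ?d x y + g"
      using tiling_dist_less_iff[OF 1(1), of N \<T> x y] g by auto
    obtain s where s: "s \<in> matching_radii N \<T> y z" "s < ?d y z + g"
      using tiling_dist_less_iff[OF 1(2), of N \<T> y z] g by auto
    note rs = r s
    have lt: "r + s < ?d x z" using rs g2 by linarith
    then have "r + s \<in> matching_radii N \<T> x z"
      using matching_radii_add[OF assms(1) xyz rs(1,3)] b(1) by linarith
    then show False using tiling_dist_less_iff[OF b(1), of N \<T> x z] lt by blast
  qed
qed

end

theory Submission
  imports Defs "HOL-Library.Diagonal_Subsequence"
begin

text \<open>Compactness is proved by a diagonal argument. Every tiling is a translate, by a bounded vector,
  of one containing a tile from a fixed finite set \<open>G\<close>. The tiles meeting a connected bounded set are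
  linked by adjacency, and their number is bounded by packing; as each tile has finitely many
  possible neighbours, only finitely many tiles near the origin occur in tilings that meet \<open>G\<close>.
  Conversely, a finite net \<open>K\<close> of the tiling space suffices: a two-tile patch, moved so that its tiles
  share the origin, reappears near the origin in a tiling of \<open>K\<close>, up to a small translation.\<close>

section \<open>Translations of tiles and of whole tilings\<close>

lemma translation_unique:
  fixes A :: "'a::euclidean_space set"
  assumes "compact A" "A \<noteq> {}" "(\<lambda>p. p - v) ` A = (\<lambda>p. p - w) ` A"
  shows "v = w"
proof -
  \<comment> \<open>The hypothesis makes \<open>A\<close> invariant under the shift by
    \<open>- t\<close>. A minimiser \<open>p\<close> of \<open>p \<bullet> t\<close> on
    \<open>A\<close> would then yield the point \<open>p - t\<close> of \<open>A\<close>, whose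
    value is lower by \<open>t \<bullet> t\<close>, so \<open>t = 0\<close>.\<close>
  define t where "t = v - w"
  have "continuous_on A (\<lambda>p. p \<bullet> t)" by (intro continuous_intros)
  then obtain p where p: "p \<in> A" "\<And>q. q \<in> A \<Longrightarrow> p \<bullet> t \<le> q \<bullet> t"
    using continuous_attains_inf[OF assms(1,2)] by blast
  have "p - v \<in> (\<lambda>p. p - w) ` A" using p(1) assms(3) by blast
  then obtain q where q: "q \<in> A" "p - v = q - w" by blast
  have "q = p - t" using q(2) by (simp add: t_def algebra_simps)
  then have "p \<bullet> t \<le> (p - t) \<bullet> t" using p(2)[OF q(1)] by simp
  then have "t \<bullet> t \<le> 0" by (simp add: inner_diff_left)
  then have "t = 0" by (metis inner_eq_zero_iff inner_ge_zero order_antisym)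
  then show ?thesis by (simp add: t_def)
qed

lemma interior_shift: "interior ((\<lambda>p. p - v) ` D) = (\<lambda>p. p - v) ` interior D"
  for v :: "'a::euclidean_space"
  using interior_translation[of "- v" D] by (simp add: add.commute)

lemma closure_shift: "closure ((\<lambda>p. p - v) ` D) = (\<lambda>p. p - v) ` closure D"
  for v :: "'a::euclidean_space"
  using closure_translation[of "- v" D] by (simp add: add.commute)

lemma tile_shift:
  assumes "tile D"
  shows "tile ((\<lambda>p. p - v) ` D)"
proof -
  have "(\<lambda>p. p - v) ` D = (\<lambda>p. p - v) ` closure (interior D)"
    using assms unfolding tile_def by metis
  moreover have "compact ((\<lambda>p. p - v) ` D)" "connected ((\<lambda>p. p - v) ` D)"
    using assms unfolding tile_def
    by (auto intro!: compact_continuous_image connected_continuous_image continuous_intros)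
  ultimately show ?thesis
    using assms unfolding tile_def interior_shift closure_shift by blast
qed

lemma prototile_shift:
  assumes "P \<in> prototiles" "D \<in> P"
  shows "tile D" "(\<lambda>p. p - v) ` D \<in> P"
proof -
  obtain F where P: "P = tile_equiv `` {F}"
    using assms(1) unfolding prototiles_def quotient_def by blast
  obtain w where w: "tile F" "tile D" "D = (\<lambda>p. p - w) ` F"
    using assms(2) unfolding P tile_equiv_def by blast
  show "tile D" by (rule w)
  have "(\<lambda>p. p - v) ` D = (\<lambda>p. p - (w + v)) ` F"
    unfolding w(3) by (simp add: image_image algebra_simps)
  then show "(\<lambda>p. p - v) ` D \<in> P"
    using w(1) tile_shift[OF w(2), of v] unfolding P tile_equiv_def by blast
qed

text \<open>Allows tilings to be recentred: \<open>patch_translate\<close> asks for an ambient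
  tiling, and both directions of the equivalence move a tile or a point to the origin.\<close>

lemma tiling_space_translate:
  assumes "\<T> \<subseteq> prototiles" "x \<in> tiling_space \<T>"
  shows "translate v x \<in> tiling_space \<T>"
proof -
  have "tile D" if "D \<in> translate v x" for D
    using that tile_shift tiling_spaceD(1)[OF assms(2)] unfolding translate_def by blast
  moreover have "pairwise (\<lambda>D E. interior D \<inter> interior E = {}) (translate v x)"
  proof (rule pairwiseI)
    fix D E assume DE: "D \<in> translate v x" "E \<in> translate v x" "D \<noteq> E"
    then obtain D' E' where *: "D' \<in> x" "E' \<in> x" "D = (\<lambda>p. p - v) ` D'" "E = (\<lambda>p. p - v) ` E'"
      unfolding translate_def by blast
    have "pairwise (\<lambda>D E. interior D \<inter> interior E = {}) x"
      using assms(2) unfolding tiling_space_def tiling_def by simp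
    moreover have "D' \<noteq> E'" using DE(3) *(3,4) by blast
    ultimately have "interior D' \<inter> interior E' = {}" using *(1,2) by (auto dest: pairwiseD)
    then show "interior D \<inter> interior E = {}"
      unfolding *(3,4) interior_shift by auto
  qed
  moreover have "\<Union>(translate v x) = UNIV"
    unfolding translate_props(3) tiling_spaceD(2)[OF assms(2)]
    by (rule surjI[of _ "\<lambda>p. p + v"]) simp
  moreover have "\<exists>P\<in>\<T>. D \<in> P" if "D \<in> translate v x" for D
  proof -
    obtain D' where D': "D' \<in> x" "D = (\<lambda>p. p - v) ` D'" using \<open>D \<in> translate v x\<close> unfolding translate_def by blast
    then obtain P where "P \<in> \<T>" "D' \<in> P" using tiling_spaceD(3)[OF assms(2)] by blast
    then show ?thesis using prototile_shift(2)[of P D' v] D'(2) assms(1) by blast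
  qed
  ultimately show ?thesis unfolding tiling_space_def tiling_def by blast
qed

section \<open>Adjacency of tiles and the finitely many tiles near the origin\<close>

lemma patchesI_pair:
  assumes "x \<in> tiling_space \<T>" "D \<in> x" "E \<in> x" "D \<inter> E \<noteq> {}"
  shows "{D, E} \<in> patches \<T>"
proof -
  have "connected (D \<union> E)"
    using assms(4) tiling_spaceD(1)[OF assms(1)] assms(2,3) by (intro connected_Un) (auto simp: tile_def)
  then show ?thesis using assms(1-3) unfolding patches_def by auto
qed

text \<open>Disjoint nonempty closed sets would disconnect the support. Together with
  \<open>patchesI_pair\<close> this identifies adjacency within a tiling with membership in
  \<open>patches\<close>, the case \<open>D = E\<close> included.\<close>

lemma patch_pair_touches:
  assumes "{D, E} \<in> patches \<T>"
  shows "tile D" "tile E" "D \<inter> E \<noteq> {}"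
proof -
  obtain x where x: "x \<in> tiling_space \<T>" "D \<in> x" "E \<in> x" and c: "connected (D \<union> E)"
    using assms unfolding patches_def by auto
  show t: "tile D" "tile E" using tiling_spaceD(1)[OF x(1)] x by auto
  show "D \<inter> E \<noteq> {}"
  proof
    assume "D \<inter> E = {}"
    moreover have "closed D" "closed E" "D \<noteq> {}" "E \<noteq> {}"
      using t by (auto simp: tile_def compact_imp_closed)
    ultimately show False using c connected_closed[of "D \<union> E"] by blast
  qed
qed

text \<open>A neighbour \<open>E\<close> is determined by the protopatch of \<open>{D, E}\<close>,
  by the tile of a representative that is moved onto \<open>D\<close>, and by the vector moving it,
  which \<open>translation_unique\<close> makes unique. The case \<open>E = D\<close> gives a
  one-tile patch, which \<open>protopatches \<T> 2\<close> does not count, so \<open>D\<close> is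
  added by hand.\<close>

lemma finite_adjacent:
  assumes "finite_local_complexity \<T>"
  shows "finite {E. {D, E} \<in> patches \<T>}"
proof (cases "tile D")
  case True
  have fin: "finite {E. \<exists>v. {D, E} = translate v {A, B}}" for A B
  proof -
    have one: "finite {v. (\<lambda>p. p - v) ` C = D}" for C
    proof (cases "\<exists>w. (\<lambda>p. p - w) ` C = D")
      case ex: True
      then obtain w where w: "(\<lambda>p. p - w) ` C = D" by blast
      have "C = (\<lambda>p. p - (- w)) ` D" unfolding w[symmetric] by (simp add: image_image)
      then have "compact C" "C \<noteq> {}" using tile_shift[OF True, of "- w"] by (auto simp: tile_def)
      then have "{v. (\<lambda>p. p - v) ` C = D} \<subseteq> {w}" using translation_unique[of C] w by blast
      then show ?thesis by (rule finite_subset) simp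
    qed simp
    \<comment> \<open>Equality of unordered pairs makes \<open>D\<close> the image of
      \<open>A\<close> or of \<open>B\<close>, and \<open>E\<close> the image of the other one under
      the same vector.\<close>
    have "{E. \<exists>v. {D, E} = translate v {A, B}}
        \<subseteq> (\<lambda>v. (\<lambda>p. p - v) ` B) ` {v. (\<lambda>p. p - v) ` A = D}
          \<union> (\<lambda>v. (\<lambda>p. p - v) ` A) ` {v. (\<lambda>p. p - v) ` B = D}"
      unfolding translate_def by (auto simp: doubleton_eq_iff)
    then show ?thesis by (rule finite_subset) (use one in auto)
  qed
  have "{E. {D, E} \<in> patches \<T>} \<subseteq> insert D (\<Union>Q\<in>protopatches \<T> 2. {E. {D, E} \<in> Q})"
  proof
    fix E assume "E \<in> {E. {D, E} \<in> patches \<T>}"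
    then have p: "{D, E} \<in> patches \<T>" by simp
    show "E \<in> insert D (\<Union>Q\<in>protopatches \<T> 2. {E. {D, E} \<in> Q})"
    proof (cases "E = D")
      case False
      let ?Q = "patch_equiv \<T> `` {{D, E}}"
      have "card y = 2" if y: "y \<in> ?Q" for y
      proof -
        obtain v where "y = translate v {D, E}" using y unfolding patch_equiv_def by blast
        moreover have "inj_on (\<lambda>D. (\<lambda>p. p - v) ` D) {D, E}"
          by (rule inj_on_inverseI[of _ "\<lambda>D. (\<lambda>p. p + v) ` D"]) (simp add: image_image)
        ultimately show ?thesis using False unfolding translate_def by (simp add: card_image)
      qed
      then have "?Q \<in> protopatches \<T> 2" using p unfolding protopatches_def quotient_def by blast
      moreover have "{D, E} \<in> ?Q" using p translate_props(1)[of "{D, E}"] unfolding patch_equiv_def by auto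
      ultimately show ?thesis by blast
    qed simp
  qed
  moreover have "finite {E. {D, E} \<in> Q}" if Q: "Q \<in> protopatches \<T> 2" for Q
  proof -
    obtain y where y: "y \<in> patches \<T>" "Q = patch_equiv \<T> `` {y}"
      using Q unfolding protopatches_def quotient_def by blast
    have "y \<in> Q" using y translate_props(1)[of y] unfolding patch_equiv_def by auto
    then have "card y = 2" using Q unfolding protopatches_def by blast
    then obtain A B where "y = {A, B}" by (meson card_2_iff)
    then have "{E. {D, E} \<in> Q} \<subseteq> {E. \<exists>v. {D, E} = translate v {A, B}}"
      using y(2) unfolding patch_equiv_def by blast
    then show ?thesis using fin by (rule finite_subset)
  qed
  moreover have "finite (protopatches \<T> 2)" using assms unfolding finite_local_complexity_def by blast
  ultimately show ?thesis by (auto intro: finite_subset)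
next
  case False
  then have "{E. {D, E} \<in> patches \<T>} = {}" using patch_pair_touches(1) by blast
  then show ?thesis by simp
qed

text \<open>Breadth-first search along adjacency. Successive adjacencies may be realised in
  different tilings, so a stage depends on \<open>\<T>\<close> and \<open>G\<close> alone and serves
  all tilings at once.\<close>

primrec chain :: "'a::euclidean_space set set set \<Rightarrow> 'a set set \<Rightarrow> nat \<Rightarrow> 'a set set" where
  "chain \<T> G 0 = G"
| "chain \<T> G (Suc k) = chain \<T> G k \<union> (\<Union>D\<in>chain \<T> G k. {E. {D, E} \<in> patches \<T>})"

lemma finite_chain:
  assumes "finite_local_complexity \<T>" "finite G"
  shows "finite (chain \<T> G k)"
  using assms by (induction k) (auto simp: finite_adjacent)

text \<open>As long as a tile of \<open>x\<close> meeting \<open>L\<close> is missing, connectedness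
  of \<open>L\<close> makes some reached tile touch a missing one, and the next stage gains at least
  that tile. The strict inequality counts \<open>F\<close>, which is present from stage 0.\<close>

lemma chain_grows:
  assumes x: "x \<in> tiling_space \<T>" and L: "connected L"
    and fin: "finite {E \<in> x. E \<inter> L \<noteq> {}}" and F: "F \<in> x" "F \<in> G" "F \<inter> L \<noteq> {}"
  shows "{E \<in> x. E \<inter> L \<noteq> {}} \<subseteq> chain \<T> G k \<or> k < card ({E \<in> x. E \<inter> L \<noteq> {}} \<inter> chain \<T> G k)"
proof (induction k)
  case 0
  have "F \<in> {E \<in> x. E \<inter> L \<noteq> {}} \<inter> chain \<T> G 0" using F by simp
  then show ?case 
    using fin by (auto simp: card_gt_0_iff simp del: chain.simps)
next
  case (Suc k)
  define S where "S = {E \<in> x. E \<inter> L \<noteq> {}}"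
  define A where "A = S \<inter> chain \<T> G k"
  define B where "B = S - chain \<T> G k"
  have cl: "closed E" if "E \<in> S" for E
    using that tiling_spaceD(1)[OF x] by (auto simp: S_def tile_def compact_imp_closed)
  have S: "finite S" "S = A \<union> B" "S \<subseteq> x" using fin by (auto simp: S_def A_def B_def)
  have FA: "F \<in> A"
  proof -
    have "F \<in> chain \<T> G k" by (induction k) (use F in auto)
    then show ?thesis using F by (auto simp: A_def S_def)
  qed
  show ?case
  proof (cases "B = {}")
    case True
    then show ?thesis by (auto simp: B_def S_def)
  next
    case False
    \<comment> \<open>The reached and the missing tiles form two finite unions of closed sets that
      cover \<open>L\<close> and both meet it. If they had no common point in \<open>L\<close>, they
      would disconnect it.\<close>
    have "\<Union>A \<inter> \<Union>B \<inter> L \<noteq> {}"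
    proof
      assume "\<Union>A \<inter> \<Union>B \<inter> L = {}"
      moreover have "closed (\<Union>A)" "closed (\<Union>B)"
        using S cl by (auto intro!: closed_Union simp: finite_subset)
      moreover have "L \<subseteq> \<Union>A \<union> \<Union>B"
      proof
        fix p assume p: "p \<in> L"
        obtain E where "E \<in> x" "p \<in> E" using tiling_spaceD(2)[OF x] by blast
        then have "E \<in> S" using p by (auto simp: S_def)
        then show "p \<in> \<Union>A \<union> \<Union>B" using \<open>p \<in> E\<close> S(2) by blast
      qed
      moreover have "\<Union>A \<inter> L \<noteq> {}" using FA F by blast
      moreover have "\<Union>B \<inter> L \<noteq> {}" using False by (auto simp: B_def S_def)
      ultimately show False using L unfolding connected_closed by blast
    qed
    then obtain D E where DE: "D \<in> A" "E \<in> B" "D \<inter> E \<noteq> {}" by blast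
    then have "{D, E} \<in> patches \<T>" using S by (intro patchesI_pair[OF x]) auto
    then have "insert E A \<subseteq> S \<inter> chain \<T> G (Suc k)" using DE by (auto simp: A_def B_def)
    then have "card (insert E A) \<le> card (S \<inter> chain \<T> G (Suc k))"
      using S(1) by (intro card_mono) auto
    moreover have "card (insert E A) = Suc (card A)"
    proof (rule card_insert_disjoint)
      show "finite A" using S(1) by (simp add: A_def)
      show "E \<notin> A" using DE(2) by (simp add: A_def B_def)
    qed
    moreover have "k < card A"
    proof -
      have "S \<subseteq> chain \<T> G k \<or> k < card A" using Suc.IH unfolding A_def S_def .
      then show ?thesis using False unfolding B_def by blast
    qed
    ultimately show ?thesis by (simp add: S_def)
  qed
qed

text \<open>Distinct tiles contain disjoint balls of a common radius, so at most one of their centres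
  lies in each ball of half that radius in a finite cover of the relevant bounded region.\<close>

lemma tiles_near_card_bound:
  fixes \<T> :: "'a::euclidean_space set set set"
  assumes "finite \<T>" "\<T> \<subseteq> prototiles" "bounded B"
  shows "\<exists>M. \<forall>x\<in>tiling_space \<T>. card {D \<in> x. D \<inter> B \<noteq> {}} \<le> M"
proof -
  from prototiles_ball[OF assms(1,2)] obtain e R where e: "e > 0"
    "\<forall>P\<in>\<T>. \<forall>D\<in>P. \<exists>c. ball c e \<subseteq> D \<and> D \<subseteq> ball c R" by blast
  obtain b where b: "\<And>p. p \<in> B \<Longrightarrow> norm p \<le> b" using assms(3) unfolding bounded_iff by blast
  \<comment> \<open>The centre \<open>c\<close> of a tile meeting \<open>B\<close> is within
    \<open>R\<close> of a point of norm at most \<open>b\<close>, hence lies in this ball.\<close>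
  have cover: "cball (0::'a) (R + b) \<subseteq> (\<Union>k\<in>UNIV. ball k (e / 2))"
  proof
    fix p :: 'a
    have "p \<in> ball p (e / 2)" using e(1) by simp
    then show "p \<in> (\<Union>k\<in>UNIV. ball k (e / 2))" by blast
  qed
  obtain K where K: "finite K" "cball (0::'a) (R + b) \<subseteq> (\<Union>k\<in>K. ball k (e / 2))"
    by (rule compactE_image[OF compact_cball open_ball cover])
  have "card {D \<in> x. D \<inter> B \<noteq> {}} \<le> card K" if x: "x \<in> tiling_space \<T>" for x
  proof -
    let ?S = "{D \<in> x. D \<inter> B \<noteq> {}}"
    have "\<forall>D\<in>?S. \<exists>k. k \<in> K \<and> (\<exists>c. ball c e \<subseteq> D \<and> c \<in> ball k (e / 2))"
    proof
      fix D assume "D \<in> ?S"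
      then obtain p where p: "D \<in> x" "p \<in> D" "p \<in> B" by blast
      obtain c where c: "ball c e \<subseteq> D" "D \<subseteq> ball c R" using tiling_spaceD(3)[OF x p(1)] e(2) by blast
      have "dist c p < R" using c(2) p(2) by auto
      then have "norm c \<le> R + b" using b[OF p(3)] norm_triangle_ineq2[of c p] by (simp add: dist_norm)
      then have "c \<in> cball 0 (R + b)" by simp
      then have "c \<in> (\<Union>k\<in>K. ball k (e / 2))" using K(2) by (rule rev_subsetD)
      then show "\<exists>k. k \<in> K \<and> (\<exists>c. ball c e \<subseteq> D \<and> c \<in> ball k (e / 2))" using c(1) by blast
    qed
    from bchoice[OF this] obtain k where
      k: "\<forall>D\<in>?S. k D \<in> K \<and> (\<exists>c. ball c e \<subseteq> D \<and> c \<in> ball (k D) (e / 2))" by blast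
    have "inj_on k ?S"
    proof (rule inj_onI)
      fix D E assume DE: "D \<in> ?S" "E \<in> ?S" "k D = k E"
      obtain c where c: "ball c e \<subseteq> D" "c \<in> ball (k D) (e / 2)" using bspec[OF k DE(1)] by blast
      obtain c' where c': "ball c' e \<subseteq> E" "c' \<in> ball (k D) (e / 2)"
        using bspec[OF k DE(2)] DE(3) by auto
      have "dist c c' < e" using c(2) c'(2) dist_triangle_half_r[of "k D" c e c'] by simp
      then have int: "c' \<in> interior D" using c(1) by (intro interiorI[of "ball c e"]) auto
      have "c' \<in> E" using c'(1) e(1) by auto
      then show "D = E" using DE(1,2) tiling_spaceD(4)[OF x _ _ int] by blast
    qed
    moreover have "k ` ?S \<subseteq> K" using k by (intro image_subsetI) simp
    ultimately show ?thesis using K(1) by (rule card_inj_on_le)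
  qed
  then show ?thesis by (intro exI ballI)
qed

text \<open>The packing bound \<open>M\<close> limits how long \<open>chain_grows\<close> can keep
  adding tiles: at stage \<open>M\<close> its second alternative would exceed the bound. So the
  finite set \<open>chain \<T> G M\<close>, the same for every tiling, contains all these
  tiles.\<close>

lemma finite_tiles_near:
  fixes \<T> :: "'a::euclidean_space set set set"
  assumes FLC: "finite_local_complexity \<T>" and G: "finite G" "\<And>F. F \<in> G \<Longrightarrow> F \<inter> L \<noteq> {}"
    and L: "connected L" "bounded L"
  shows "finite {D. D \<inter> L \<noteq> {} \<and> (\<exists>x\<in>tiling_space \<T>. D \<in> x \<and> x \<inter> G \<noteq> {})}"
proof -
  have T: "finite \<T>" "\<T> \<subseteq> prototiles" using FLC unfolding finite_local_complexity_def by auto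
  obtain M where M: "\<And>x. x \<in> tiling_space \<T> \<Longrightarrow> card {D \<in> x. D \<inter> L \<noteq> {}} \<le> M"
    using tiles_near_card_bound[OF T L(2)] by blast
  have "{D. D \<inter> L \<noteq> {} \<and> (\<exists>x\<in>tiling_space \<T>. D \<in> x \<and> x \<inter> G \<noteq> {})} \<subseteq> chain \<T> G M"
  proof
    fix D assume "D \<in> {D. D \<inter> L \<noteq> {} \<and> (\<exists>x\<in>tiling_space \<T>. D \<in> x \<and> x \<inter> G \<noteq> {})}"
    then obtain x F where x: "x \<in> tiling_space \<T>" "D \<in> x" "D \<inter> L \<noteq> {}" "F \<in> x" "F \<in> G" by blast
    let ?S = "{D \<in> x. D \<inter> L \<noteq> {}}"
    have fin: "finite ?S" by (rule tiling_locally_finite[OF T x(1) L(2)])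
    have "card (?S \<inter> chain \<T> G M) \<le> card ?S" using fin by (intro card_mono) auto
    then have "\<not> M < card (?S \<inter> chain \<T> G M)" using M[OF x(1)] by simp
    then have "?S \<subseteq> chain \<T> G M" using chain_grows[OF x(1) L(1) fin x(4,5) G(2)[OF x(5)], of M] by blast
    then show "D \<in> chain \<T> G M" using x by blast
  qed
  then show ?thesis using finite_chain[OF FLC G(1)] by (rule finite_subset)
qed

section \<open>Tiling distance between translates of tilings that agree near the origin\<close>

lemma covering_patch_translate:
  assumes N: "is_norm N" and T: "finite \<T>" "\<T> \<subseteq> prototiles" and y: "y \<in> tiling_space \<T>"
    and s: "0 < s" "s + N v \<le> n"
  shows "translate v {D \<in> y. D \<inter> norm_ball N n \<noteq> {}} \<in> covering_patches \<T> (translate v y) (norm_ball N s)"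
proof -
  let ?A = "{D \<in> y. D \<inter> norm_ball N n \<noteq> {}}"
  have 0: "0 \<in> norm_ball N n" using is_normD(1,6)[OF N] s by (simp add: norm_ball_def) (smt (verit))
  have "?A \<in> covering_patches \<T> y (norm_ball N n)"
  proof (rule patch_touching[OF y])
    show "finite ?A" by (rule tiling_locally_finite[OF T y norm_ball_props(3)[OF N]])
    show "connected (norm_ball N n)" using norm_ball_props(1)[OF N] convex_connected by blast
  qed (use 0 tiling_spaceD(2)[OF y] in auto)
  then have A: "?A \<in> patches \<T>" "norm_ball N n \<subseteq> \<Union>?A" unfolding covering_patches_def by auto
  have sub: "translate v ?A \<subseteq> translate v y" by (rule translate_props(4)) auto
  have "norm_ball N s \<subseteq> \<Union>(translate v ?A)"
    unfolding translate_props(3)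
  proof
    fix p assume "p \<in> norm_ball N s"
    then have "N (p + v) \<le> n" using is_normD(4)[OF N, of p v] s by (simp add: norm_ball_def)
    then have "p + v \<in> \<Union>?A" using A(2) by (auto simp: norm_ball_def)
    then show "p \<in> (\<lambda>p. p - v) ` \<Union>?A" by (rule image_eqI[rotated]) simp
  qed
  then show ?thesis
    using patch_translate[OF A(1) sub tiling_space_translate[OF T(2) y]] sub
    unfolding covering_patches_def by blast
qed

text \<open>The common pattern on the large ball, moved by \<open>v\<close> and by \<open>w\<close>,
  gives two patches that differ by \<open>w - v\<close>. The moves cost at most \<open>N v\<close>
  and \<open>N w\<close> of the covered radius, which leaves \<open>1 / r\<close>, so
  \<open>r\<close> itself is a matching radius.\<close>

lemma tiling_dist_translates_less:
  assumes N: "is_norm N" and T: "finite \<T>" "\<T> \<subseteq> prototiles"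
    and y: "y \<in> tiling_space \<T>" "z \<in> tiling_space \<T>"
    and eq: "{D \<in> y. D \<inter> norm_ball N n \<noteq> {}} = {D \<in> z. D \<inter> norm_ball N n \<noteq> {}}"
    and r: "0 < r" "r < 1 / sqrt 2" "1 / r + N v \<le> n" "1 / r + N w \<le> n" "N (w - v) \<le> r" "r < t" "t \<le> 1 / sqrt 2"
  shows "tiling_dist N \<T> (translate v y) (translate w z) < t"
proof -
  let ?A = "{D \<in> y. D \<inter> norm_ball N n \<noteq> {}}"
  have "translate v ?A \<in> covering_patches \<T> (translate v y) (norm_ball N (1 / r))"
    using r by (intro covering_patch_translate[OF N T y(1)]) auto
  moreover have "translate w ?A \<in> covering_patches \<T> (translate w z) (norm_ball N (1 / r))"
    unfolding eq using r by (intro covering_patch_translate[OF N T y(2)]) auto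
  moreover have "translate (w - v) (translate v ?A) = translate w ?A"
    by (simp add: translate_props(2))
  moreover have "w - v \<in> norm_ball N r" using r by (simp add: norm_ball_def)
  ultimately have "r \<in> matching_radii N \<T> (translate v y) (translate w z)"
    unfolding matching_radii_def using r(1,2) by blast
  then show ?thesis using tiling_dist_less_iff[OF r(7)] r(6) by blast
qed

section \<open>From compactness to finite local complexity\<close>

lemma patch_equiv_class_translate:
  assumes "y \<in> patches \<T>" "translate v y \<in> patches \<T>"
  shows "patch_equiv \<T> `` {y} = patch_equiv \<T> `` {translate v y}"
proof -
  have "(\<exists>w. z = translate w y) \<longleftrightarrow> (\<exists>w. z = translate w (translate v y))" for z
    unfolding translate_props(2) by (metis add.commute diff_add_cancel)
  then show ?thesis using assms unfolding patch_equiv_def by auto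
qed

lemma prototile_diameter:
  fixes \<T> :: "'a::euclidean_space set set set"
  assumes "finite \<T>" "\<T> \<subseteq> prototiles"
  shows "\<exists>R>0. \<forall>P\<in>\<T>. \<forall>D\<in>P. \<forall>p\<in>D. \<forall>q\<in>D. norm (p - q) \<le> R"
proof -
  from prototiles_ball[OF assms] obtain e R where
    R: "\<forall>P\<in>\<T>. \<forall>D\<in>P. \<exists>c. ball c e \<subseteq> D \<and> D \<subseteq> ball c R" by blast
  \<comment> \<open>\<open>prototiles_ball\<close> says nothing about the sign of \<open>R\<close>;
    this form of the bound is positive in any case.\<close>
  have "norm (p - q) \<le> 2 * \<bar>R\<bar> + 1" if PD: "P \<in> \<T>" "D \<in> P" "p \<in> D" "q \<in> D" for P D p q
  proof -
    obtain c where "D \<subseteq> ball c R" using bspec[OF bspec[OF R PD(1)] PD(2)] by blast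
    then have "dist c p < R" "dist c q < R" using PD(3,4) by auto
    then have "dist p q < 2 * R" using dist_triangle2[of p q c] by (simp add: dist_commute)
    then show ?thesis by (simp add: dist_norm)
  qed
  then have "\<forall>P\<in>\<T>. \<forall>D\<in>P. \<forall>p\<in>D. \<forall>q\<in>D. norm (p - q) \<le> 2 * \<bar>R\<bar> + 1" by simp
  moreover have "2 * \<bar>R\<bar> + 1 > 0" by simp
  ultimately show ?thesis by (intro exI conjI)
qed

lemma compact_imp_finite_local_complexity:
  fixes \<T> :: "'a::euclidean_space set set set"
  assumes N: "is_norm N" and T: "finite \<T>" "\<T> \<subseteq> prototiles"
    and compact: "compact_space (Metric_space.mtopology (tiling_space \<T>) (tiling_dist N \<T>))"
  shows "finite_local_complexity \<T>"
proof -
  interpret Metric_space "tiling_space \<T>" "tiling_dist N \<T>"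
    by (rule Metric_space_tiling_dist[OF N T])
  from prototile_diameter[OF T] obtain R where
    "R > 0" "\<forall>P\<in>\<T>. \<forall>D\<in>P. \<forall>p\<in>D. \<forall>q\<in>D. norm (p - q) \<le> R" by blast
  then have R: "R > 0" "\<And>P D p q. P \<in> \<T> \<Longrightarrow> D \<in> P \<Longrightarrow> p \<in> D \<Longrightarrow> q \<in> D \<Longrightarrow> norm (p - q) \<le> R"
    by simp_all
  obtain C where C: "C > 0" "\<And>u. N u \<le> C * norm u" using is_norm_bounded[OF N] by blast
  \<comment> \<open>A tile containing the origin lies in the ball of \<open>N\<close>-radius
    \<open>C * R\<close>. The lower bound 2 brings \<open>r = 1 / s\<close> below
    \<open>1 / sqrt 2\<close>, as \<open>tiling_dist_less_iff\<close> requires, and below 1.\<close>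
  define s where "s = max 2 (C * R)"
  define r where "r = 1 / s"
  have s: "2 \<le> s" "C * R \<le> s" by (auto simp: s_def)
  have r: "0 < r" "r \<le> 1 / sqrt 2" "r \<le> 1"
  proof -
    have "sqrt 2 \<le> sqrt (2 * 2)" by (subst real_sqrt_le_iff) simp
    then have "sqrt 2 \<le> 2" by simp
    then have "sqrt 2 \<le> s" using s by linarith
    then show "0 < r" "r \<le> 1 / sqrt 2" "r \<le> 1" using s by (auto simp: r_def intro!: frac_le)
  qed
  have "mtotally_bounded (tiling_space \<T>)"
    using compact by (simp add: compact_space_eq_mcomplete_mtotally_bounded)
  then have "\<exists>K. finite K \<and> K \<subseteq> tiling_space \<T> \<and> tiling_space \<T> \<subseteq> (\<Union>x\<in>K. mball x r)"
    using r(1) unfolding mtotally_bounded_def by simp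
  then obtain K where K: "finite K" "K \<subseteq> tiling_space \<T>" "tiling_space \<T> \<subseteq> (\<Union>x\<in>K. mball x r)"
    by (elim exE conjE)
  let ?V = "norm_ball N 1"
  \<comment> \<open>A finite supply of candidate representatives, read off near the origin from the
    tilings of the net.\<close>
  define Z where "Z = (\<Union>x\<in>K. Pow {E \<in> x. E \<inter> ?V \<noteq> {}})"
  have "finite Z" unfolding Z_def
    using K tiling_locally_finite[OF T _ norm_ball_props(3)[OF N]] by blast
  moreover have "protopatches \<T> 2 \<subseteq> (\<lambda>z. patch_equiv \<T> `` {z}) ` Z"
  proof
    fix Q assume Q: "Q \<in> protopatches \<T> 2"
    obtain y where y: "y \<in> patches \<T>" "Q = patch_equiv \<T> `` {y}"
      using Q unfolding protopatches_def quotient_def by blast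
    have "y \<in> Q" using y translate_props(1)[of y] unfolding patch_equiv_def by auto
    then have "card y = 2" using Q unfolding protopatches_def by blast
    then obtain D E where DE: "y = {D, E}" by (meson card_2_iff)
    then obtain p where p: "p \<in> D" "p \<in> E" using y patch_pair_touches(3) by blast
    obtain x where x: "x \<in> tiling_space \<T>" "y \<subseteq> x" using y unfolding patches_def by blast
    have px: "translate p x \<in> tiling_space \<T>" by (rule tiling_space_translate[OF T(2) x(1)])
    then obtain k where k: "k \<in> K" "tiling_dist N \<T> k (translate p x) < r" using K(3) by auto
    have kX: "k \<in> tiling_space \<T>" using k K by blast
    obtain t where t: "t \<in> matching_radii N \<T> k (translate p x)" "t < r"
      using k(2) tiling_dist_less_iff[OF r(2)] by blast
    then obtain k' x' v where kx: "0 < t"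
      "k' \<in> covering_patches \<T> k (norm_ball N (1 / t))"
      "x' \<in> covering_patches \<T> (translate p x) (norm_ball N (1 / t))"
      "v \<in> norm_ball N t" "translate v k' = x'" unfolding matching_radii_def by blast
    have "s \<le> 1 / t" using kx(1) t(2) s by (simp add: r_def field_simps)
    then have cov: "norm_ball N s \<subseteq> \<Union>x'" "x' \<subseteq> translate p x"
      using kx(3) unfolding covering_patches_def norm_ball_def by auto
    have sub: "translate p y \<subseteq> x'" and 0: "\<And>F. F \<in> translate p y \<Longrightarrow> 0 \<in> F"
    proof -
      show 0: "0 \<in> F" if "F \<in> translate p y" for F
        using that p unfolding DE translate_def by auto
      show "translate p y \<subseteq> x'"
      proof
        fix F assume F: "F \<in> translate p y"
        then have Fx: "F \<in> translate p x" using translate_props(4)[OF x(2)] by blast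
        \<comment> \<open>An interior point of \<open>F\<close> belongs to no other tile of the
          tiling, so the tile of \<open>x'\<close> that covers it must be \<open>F\<close>.\<close>
        obtain q where q: "q \<in> interior F" using tile_interior_nonempty tiling_spaceD(1)[OF px Fx] by blast
        then have qF: "q \<in> F" using interior_subset by blast
        obtain P where "P \<in> \<T>" "F \<in> P" using tiling_spaceD(3)[OF px Fx] by blast
        then have "norm q \<le> R" using R(2)[of P F q 0] qF 0[OF F] by simp
        then have "C * norm q \<le> C * R" using C(1) by simp
        then have "N q \<le> s" using C(2)[of q] s(2) by linarith
        then obtain H where H: "H \<in> x'" "q \<in> H" using cov(1) by (auto simp: norm_ball_def)
        have "F = H" using tiling_spaceD(4)[OF px Fx _ q H(2)] H(1) cov(2) by blast
        then show "F \<in> x'" using H by simp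
      qed
    qed
    \<comment> \<open>Undoing the matching vector \<open>v\<close> carries the recentred pair into
      \<open>k\<close>. The shared point moves from the origin to \<open>v\<close>, which lies in
      the unit ball because \<open>t < r \<le> 1\<close>.\<close>
    define z where "z = translate (p - v) y"
    have z: "z = translate (- v) (translate p y)" by (simp add: z_def translate_props(2))
    have "translate (- v) x' = k'" using translate_props(1,2) kx(5) by (metis add.right_inverse)
    then have "z \<subseteq> k'" unfolding z using translate_props(4)[OF sub, of "- v"] by simp
    then have zk: "z \<subseteq> k" using kx(2) unfolding covering_patches_def by blast
    have "N v \<le> 1" using kx(4) t(2) r(3) by (simp add: norm_ball_def)
    then have vV: "v \<in> ?V" by (simp add: norm_ball_def)
    have "F \<inter> ?V \<noteq> {}" if "F \<in> z" for F
    proof -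
      obtain H where H: "H \<in> translate p y" "F = (\<lambda>q. q - (- v)) ` H"
        using \<open>F \<in> z\<close> unfolding z translate_def[of "- v"] by blast
      have "0 - (- v) \<in> F" unfolding H(2) using 0[OF H(1)] by (rule imageI)
      then show ?thesis using vV by auto
    qed
    then have "z \<in> Z" unfolding Z_def using k(1) zk by blast
    moreover have "z \<in> patches \<T>" unfolding z_def
      using zk kX by (intro patch_translate[OF y(1)]) (auto simp: z_def)
    then have "Q = patch_equiv \<T> `` {z}" unfolding y(2) z_def
      by (rule patch_equiv_class_translate[OF y(1)])
    ultimately show "Q \<in> (\<lambda>z. patch_equiv \<T> `` {z}) ` Z" by blast
  qed
  ultimately show ?thesis using T unfolding finite_local_complexity_def by (blast intro: finite_surj)
qed

section \<open>Limits of tilings and sequential compactness\<close>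

lemma diagonal_constant_subsequence:
  fixes A :: "nat \<Rightarrow> nat \<Rightarrow> 'b"
  assumes "\<And>n. finite (range (A n))"
  shows "\<exists>s :: nat \<Rightarrow> nat. strict_mono s \<and> (\<forall>n. \<exists>K. \<forall>i\<ge>K. A n (s i) = A n (s K))"
proof -
  \<comment> \<open>Constancy passes to subsequences, and the pigeonhole principle on the finite
    range of \<open>A n\<close> achieves it, as the diagonal construction demands.\<close>
  define P where "P = (\<lambda>n (s::nat \<Rightarrow> nat). \<forall>i j. A n (s i) = A n (s j))"
  interpret subseqs P
  proof
    fix n :: nat and s :: "nat \<Rightarrow> nat"
    have "finite ((\<lambda>i. A n (s i)) ` UNIV)" using assms[of n] by (rule finite_subset[rotated]) auto
    then obtain a where "infinite {i \<in> UNIV. A n (s i) = A n (s a)}"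
      using pigeonhole_infinite[of UNIV "\<lambda>i. A n (s i)"] by auto
    then have inf: "infinite {i. A n (s i) = A n (s a)}" by simp
    let ?r = "enumerate {i. A n (s i) = A n (s a)}"
    have "A n (s (?r i)) = A n (s a)" for i using enumerate_in_set[OF inf, of i] by simp
    then have "P n (s \<circ> ?r)" by (simp add: P_def)
    then show "\<exists>r'. strict_mono r' \<and> P n (s \<circ> r')" using strict_mono_enumerate[OF inf] by blast
  qed
  \<comment> \<open>The diagonal sequence obeys the \<open>n\<close>-th refinement only from index
    \<open>Suc n\<close> on, which is why stability rather than constancy is concluded.\<close>
  have "P n (diagseq \<circ> (+) (Suc n))" for n
    by (rule diagseq_holds) (simp add: P_def)
  then have *: "A n (diagseq (Suc n + i)) = A n (diagseq (Suc n + j))" for n i j by (simp add: P_def)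
  have "A n (diagseq i) = A n (diagseq (Suc n))" if "i \<ge> Suc n" for n i
    using *[of n "i - Suc n" 0] that by simp
  then have "\<forall>n. \<exists>K. \<forall>i\<ge>K. A n (diagseq i) = A n (diagseq K)" by (intro allI exI impI)
  then show ?thesis using subseq_diagseq by (intro exI[of _ diagseq] conjI)
qed

text \<open>The limit consists of the tiles that eventually belong to \<open>y i\<close>. Any two of
  them occur in a common \<open>y i\<close>, which gives disjoint interiors; a stable window around
  a point supplies a tile covering it.\<close>

lemma tiling_space_limit:
  fixes y :: "nat \<Rightarrow> 'a::euclidean_space set set"
  assumes y: "\<And>i. y i \<in> tiling_space \<T>"
    and B: "\<And>p. \<exists>n. p \<in> B n"
    and stable: "\<And>n. \<exists>K. \<forall>i\<ge>K. {D \<in> y i. D \<inter> B n \<noteq> {}} = {D \<in> y K. D \<inter> B n \<noteq> {}}"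
  shows "\<exists>z\<in>tiling_space \<T>. \<forall>n. \<forall>\<^sub>F i in sequentially. {D \<in> y i. D \<inter> B n \<noteq> {}} = {D \<in> z. D \<inter> B n \<noteq> {}}"
proof -
  define z where "z = {D. \<forall>\<^sub>F i in sequentially. D \<in> y i}"
  have near: "\<forall>\<^sub>F i in sequentially. {D \<in> y i. D \<inter> B n \<noteq> {}} = {D \<in> z. D \<inter> B n \<noteq> {}}" for n
  proof -
    obtain K where K: "\<And>i. i \<ge> K \<Longrightarrow> {D \<in> y i. D \<inter> B n \<noteq> {}} = {D \<in> y K. D \<inter> B n \<noteq> {}}"
      using stable by blast
    \<comment> \<open>Inside a stable window, eventual membership is membership at the index
      \<open>K\<close> of stabilisation.\<close>
    have "D \<in> z \<longleftrightarrow> D \<in> y K" if D: "D \<inter> B n \<noteq> {}" for D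
    proof -
      have eq: "D \<in> y i \<longleftrightarrow> D \<in> y K" if "i \<ge> K" for i using K[OF that] D by blast
      show ?thesis
      proof
        assume "D \<in> z"
        then obtain J where "\<And>j. j \<ge> J \<Longrightarrow> D \<in> y j" unfolding z_def eventually_sequentially by blast
        then show "D \<in> y K" using eq[of "max J K"] by simp
      next
        assume "D \<in> y K"
        then show "D \<in> z" using eq unfolding z_def eventually_sequentially by blast
      qed
    qed
    then have "{D \<in> z. D \<inter> B n \<noteq> {}} = {D \<in> y K. D \<inter> B n \<noteq> {}}" by blast
    then show ?thesis unfolding eventually_sequentially using K by blast
  qed
  have both: "\<exists>i. D \<in> y i \<and> E \<in> y i" if "D \<in> z" "E \<in> z" for D E
  proof -
    have "\<forall>\<^sub>F i in sequentially. D \<in> y i \<and> E \<in> y i"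
      using that unfolding z_def by (simp add: eventually_conj)
    then show ?thesis by (rule eventually_happens'[OF sequentially_bot])
  qed
  have "tile D" "\<exists>P\<in>\<T>. D \<in> P" if "D \<in> z" for D
    using both[OF that that] tiling_spaceD(1,3)[OF y] by blast+
  moreover have "pairwise (\<lambda>D E. interior D \<inter> interior E = {}) z"
  proof (rule pairwiseI)
    fix D E assume DE: "D \<in> z" "E \<in> z" "D \<noteq> E"
    then obtain i where "D \<in> y i" "E \<in> y i" using both by blast
    moreover have "pairwise (\<lambda>D E. interior D \<inter> interior E = {}) (y i)"
      using y[of i] unfolding tiling_space_def tiling_def by simp
    ultimately show "interior D \<inter> interior E = {}" using DE(3) by (auto dest: pairwiseD)
  qed
  moreover have "p \<in> \<Union>z" for p
  proof -
    obtain n where n: "p \<in> B n" using B by blast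
    obtain i where i: "{D \<in> y i. D \<inter> B n \<noteq> {}} = {D \<in> z. D \<inter> B n \<noteq> {}}"
      using eventually_happens'[OF sequentially_bot near[of n]] by blast
    obtain E where "E \<in> y i" "p \<in> E" using tiling_spaceD(2)[OF y[of i]] by blast
    then have "E \<in> {D \<in> z. D \<inter> B n \<noteq> {}}" unfolding i[symmetric] using n by blast
    then show ?thesis using \<open>p \<in> E\<close> by blast
  qed
  then have "\<Union>z = UNIV" by blast
  ultimately have "z \<in> tiling_space \<T>" unfolding tiling_space_def tiling_def by blast
  then show ?thesis using near by blast
qed

text \<open>The tile of \<open>x\<close> at the origin is shifted onto the chosen member of its
  prototile that contains the origin. The shift vector is then a point of the tile, so the diameter
  bound applies to it. The recentred tiling meets \<open>G\<close>, as
  \<open>finite_tiles_near\<close> needs.\<close>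

lemma tiling_normal_form:
  fixes \<T> :: "'a::euclidean_space set set set"
  assumes "finite \<T>" "\<T> \<subseteq> prototiles"
  shows "\<exists>G R. finite G \<and> (\<forall>F\<in>G. 0 \<in> F) \<and>
    (\<forall>x\<in>tiling_space \<T>. \<exists>v y. norm v \<le> R \<and> y \<in> tiling_space \<T> \<and> y \<inter> G \<noteq> {} \<and> x = translate v y)"
proof -
  from prototile_diameter[OF assms] obtain R where
    "\<forall>P\<in>\<T>. \<forall>D\<in>P. \<forall>p\<in>D. \<forall>q\<in>D. norm (p - q) \<le> R" by blast
  then have R: "\<And>P D p q. P \<in> \<T> \<Longrightarrow> D \<in> P \<Longrightarrow> p \<in> D \<Longrightarrow> q \<in> D \<Longrightarrow> norm (p - q) \<le> R"
    by simp
  have "\<exists>F\<in>P. 0 \<in> F" if D: "P \<in> \<T>" "D \<in> P" for P D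
  proof -
    have P: "P \<in> prototiles" using D assms by blast
    have "tile D" by (rule prototile_shift(1)[OF P D(2)])
    then obtain p where p: "p \<in> D" unfolding tile_def by blast
    then have "p - p \<in> (\<lambda>q. q - p) ` D" by (rule imageI)
    then show ?thesis using prototile_shift(2)[OF P D(2), of p] by auto
  qed
  then obtain f where f: "\<And>P D. P \<in> \<T> \<Longrightarrow> D \<in> P \<Longrightarrow> f P \<in> P \<and> 0 \<in> f P" by metis
  \<comment> \<open>\<open>f\<close> is specified only on classes that have a member, hence the
    filter.\<close>
  define G where "G = f ` {P \<in> \<T>. P \<noteq> {}}"
  have "\<exists>v y. norm v \<le> R \<and> y \<in> tiling_space \<T> \<and> y \<inter> G \<noteq> {} \<and> x = translate v y"
    if x: "x \<in> tiling_space \<T>" for x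
  proof -
    obtain D where D: "D \<in> x" "0 \<in> D" using tiling_spaceD(2)[OF x] by blast
    obtain P where P: "P \<in> \<T>" "D \<in> P" using tiling_spaceD(3)[OF x D(1)] by blast
    obtain w where w: "f P = (\<lambda>p. p - w) ` D"
      using prototile_translate[OF _ P(2), of "f P"] f[OF P] P(1) assms(2) by blast
    have "0 \<in> (\<lambda>p. p - w) ` D" using f[OF P] w by simp
    then have "w \<in> D" by auto
    then have "norm (- w) \<le> R" using R[OF P _ D(2), of w] by simp
    moreover have "f P \<in> translate w x \<inter> G"
      using w D(1) P unfolding translate_def G_def by auto
    moreover have "x = translate (- w) (translate w x)" by (simp add: translate_props(1,2))
    ultimately show ?thesis using tiling_space_translate[OF assms(2) x, of w] by blast
  qed
  moreover have "finite G" "\<forall>F\<in>G. 0 \<in> F" using assms(1) f unfolding G_def by auto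
  ultimately show ?thesis by (intro exI[of _ G] exI[of _ R]) auto
qed

text \<open>The limit found is \<open>translate l z\<close>, where \<open>l\<close> is a limit of
  the bounded translation vectors and \<open>z\<close> a limit of the recentred tilings.\<close>

lemma finite_local_complexity_imp_compact:
  fixes \<T> :: "'a::euclidean_space set set set"
  assumes N: "is_norm N" and FLC: "finite_local_complexity \<T>"
  shows "compact_space (Metric_space.mtopology (tiling_space \<T>) (tiling_dist N \<T>))"
proof -
  have T: "finite \<T>" "\<T> \<subseteq> prototiles" using FLC unfolding finite_local_complexity_def by auto
  interpret Metric_space "tiling_space \<T>" "tiling_dist N \<T>"
    by (rule Metric_space_tiling_dist[OF N T])
  obtain C where C: "C > 0" "\<And>u. N u \<le> C * norm u" using is_norm_bounded[OF N] by blast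
  from tiling_normal_form[OF T] obtain G R where G: "finite G" "\<forall>F\<in>G. 0 \<in> F"
    and nf: "\<forall>x\<in>tiling_space \<T>.
      \<exists>v y. norm v \<le> R \<and> y \<in> tiling_space \<T> \<and> y \<inter> G \<noteq> {} \<and> x = translate v y"
    by (elim exE conjE)
  define B where "B = (\<lambda>n. norm_ball N (real n))"
  have B0: "0 \<in> B n" for n using is_normD(6)[OF N] by (simp add: B_def norm_ball_def)
  have near: "finite {D. D \<inter> B n \<noteq> {} \<and> (\<exists>x\<in>tiling_space \<T>. D \<in> x \<and> x \<inter> G \<noteq> {})}" for n
  proof (rule finite_tiles_near[OF FLC G(1)])
    show "F \<inter> B n \<noteq> {}" if "F \<in> G" for F using bspec[OF G(2) that] B0[of n] by blast
    show "connected (B n)" "bounded (B n)"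
      unfolding B_def using norm_ball_props(1,3)[OF N] by (auto intro: convex_connected)
  qed
  have "\<exists>l r. l \<in> tiling_space \<T> \<and> strict_mono r \<and> limitin mtopology (\<sigma> \<circ> r) l sequentially"
    if \<sigma>: "range \<sigma> \<subseteq> tiling_space \<T>" for \<sigma> :: "nat \<Rightarrow> 'a set set"
  proof -
    have "\<exists>v y. norm v \<le> R \<and> y \<in> tiling_space \<T> \<and> y \<inter> G \<noteq> {} \<and> \<sigma> i = translate v y" for i
      using bspec[OF nf, of "\<sigma> i"] \<sigma> by blast
    then obtain v y where vy: "\<And>i. norm (v i) \<le> R" "\<And>i. y i \<in> tiling_space \<T>"
      "\<And>i. y i \<inter> G \<noteq> {}" "\<And>i. \<sigma> i = translate (v i) (y i)" by metis
    have "bounded (range v)" using vy(1) by (auto simp: bounded_iff)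
    then obtain l r1 where r1: "strict_mono r1" "(v \<circ> r1) \<longlonglongrightarrow> l"
      using bounded_imp_convergent_subsequence by blast
    \<comment> \<open>The pattern of a recentred tiling in window \<open>n\<close>. It is a subset
      of the finite set in \<open>near\<close>, so it takes finitely many values.\<close>
    define A where "A = (\<lambda>n i. {D \<in> y (r1 i). D \<inter> B n \<noteq> {}})"
    have A_fin: "finite (range (A n))" for n
    proof -
      have "A n i \<in> Pow {D. D \<inter> B n \<noteq> {} \<and> (\<exists>x\<in>tiling_space \<T>. D \<in> x \<and> x \<inter> G \<noteq> {})}" for i
        using vy(2,3)[of "r1 i"] unfolding A_def by blast
      then show ?thesis using near[of n] by (meson finite_Pow_iff finite_subset image_subsetI)
    qed
    from diagonal_constant_subsequence[of A, OF A_fin] obtain s :: "nat \<Rightarrow> nat"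
      where s: "strict_mono s" "\<forall>n. \<exists>K. \<forall>i\<ge>K. A n (s i) = A n (s K)"
      by (elim exE conjE)
    define t where "t = r1 \<circ> s"
    have t: "strict_mono t" unfolding t_def by (rule strict_mono_o[OF r1(1) s(1)])
    have vt: "(\<lambda>i. v (t i)) \<longlonglongrightarrow> l"
      using LIMSEQ_subseq_LIMSEQ[OF r1(2) s(1)] by (simp add: t_def o_def)
    have "\<exists>z\<in>tiling_space \<T>. \<forall>n. \<forall>\<^sub>F i in sequentially.
        {D \<in> y (t i). D \<inter> B n \<noteq> {}} = {D \<in> z. D \<inter> B n \<noteq> {}}"
    proof (rule tiling_space_limit)
      show "\<exists>n. p \<in> B n" for p using real_arch_simple[of "N p"] by (auto simp: B_def norm_ball_def)
      show "\<exists>K. \<forall>i\<ge>K. {D \<in> y (t i). D \<inter> B n \<noteq> {}} = {D \<in> y (t K). D \<inter> B n \<noteq> {}}" for n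
        using spec[OF s(2), of n] by (simp add: A_def t_def)
    qed (rule vy(2))
    then obtain z where z: "z \<in> tiling_space \<T>" "\<And>n. \<forall>\<^sub>F i in sequentially.
        {D \<in> y (t i). D \<inter> B n \<noteq> {}} = {D \<in> z. D \<inter> B n \<noteq> {}}" by blast
    have "\<forall>\<^sub>F i in sequentially. tiling_dist N \<T> (\<sigma> (t i)) (translate l z) < e" if e: "e > 0" for e
    proof -
      define u where "u = min e (1 / sqrt 2)"
      define r where "r = u / 2"
      have u: "0 < u" "u \<le> e" "u \<le> 1 / sqrt 2" using e by (auto simp: u_def)
      have r: "0 < r" "r < u" using u(1) by (auto simp: r_def)
      \<comment> \<open>Since \<open>C * R\<close> bounds \<open>N\<close> on all the vectors
        \<open>v i\<close>, this window still covers radius \<open>1 / r\<close> after a translation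
        by \<open>v (t i)\<close> or by \<open>l\<close>.\<close>
      obtain n where n: "1 / r + C * R + N l \<le> real n" using real_arch_simple by blast
      have "\<forall>\<^sub>F i in sequentially. dist (v (t i)) l < r / C"
        using vt r(1) C(1) by (intro tendstoD) auto
      then show ?thesis using z(2)[of n]
      proof eventually_elim
        case (elim i)
        have "N (l - v (t i)) \<le> C * norm (l - v (t i))" by (rule C(2))
        also have "\<dots> \<le> C * (r / C)" using elim(1) C(1)
          by (intro mult_left_mono) (auto simp: dist_norm norm_minus_commute)
        also have "\<dots> = r" using C(1) by simp
        finally have close: "N (l - v (t i)) \<le> r" .
        have "N (v (t i)) \<le> C * R"
          using C(2)[of "v (t i)"] mult_left_mono[OF vy(1)[of "t i"], of C] C(1) by linarith
        moreover have "0 \<le> N (v (t i))" "0 \<le> N l" using is_normD(1)[OF N] by auto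
        ultimately have "1 / r + N (v (t i)) \<le> real n" "1 / r + N l \<le> real n" using n by linarith+
        then have "tiling_dist N \<T> (translate (v (t i)) (y (t i))) (translate l z) < u"
          using r u(3) close
          by (intro tiling_dist_translates_less[OF N T vy(2) z(1) elim(2)[unfolded B_def]]) auto
        then show ?case using u(2) unfolding vy(4) by linarith
      qed
    qed
    moreover have "translate l z \<in> tiling_space \<T>" by (rule tiling_space_translate[OF T(2) z(1)])
    moreover have "\<sigma> i \<in> tiling_space \<T>" for i using \<sigma> by blast
    ultimately have "limitin mtopology (\<sigma> \<circ> t) (translate l z) sequentially"
      unfolding limitin_metric by auto
    then show ?thesis using t \<open>translate l z \<in> tiling_space \<T>\<close> by blast
  qed
  then show ?thesis unfolding compact_space_sequentially by blast
qed

theorem theorem5p3: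
  fixes N :: "real ^ 'n \<Rightarrow> real" and \<T> :: "(real ^ 'n) set set set"
  assumes "is_norm N"
    and "finite \<T>" and "\<T> \<subseteq> prototiles"
  shows "finite_local_complexity \<T> \<longleftrightarrow>
    compact_space (Metric_space.mtopology (tiling_space \<T>) (tiling_dist N \<T>))"
  using finite_local_complexity_imp_compact[OF assms(1)]
    compact_imp_finite_local_complexity[OF assms] by blast

end
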